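(* Let $\Xi=(\xi_n)_{n\ge0}$ be a time-homogeneous Markov chain on a state space $\mathbb X\subseteq\mathbb R_+$. (i) Suppose that (N) and $(\mathrm T_{\alpha,\beta,c})$ hold. Then $\Xi$ is recurrent if $$\limsup_{x\to\infty}\big(x^{\alpha-1}\mu(x)\big)<c\pi|\csc(\pi\alpha)|,$$ and $\Xi$ is transient if $$\liminf_{x\to\infty}\big(x^{\alpha-1}\mu(x)\big)>c\pi|\csc(\pi\alpha)|.$$ (ii) $\Xi$ is positive recurrent if there exist $\alpha\in(1,2)$ and $\gamma<\alpha-1$ such that $\limsup_{x\to\infty}\mathbb E_x[|\theta|^\alpha]<\infty$ and $\limsup_{x\to\infty}(x^\gamma\mu(x))<0$.
   Context: $\mathbb X$ is an infinite, unbounded, measurable subset of $\mathbb R_+$ (a standard Borel space). $\mathbb P_x,\mathbb E_x$ denote probability and expectation for the chain started at $\xi_0=x$. The increment is $\theta:=\xi_1-\xi_0$; for $y\in\mathbb R$, $y_+:=y\mathbf 1\{y\ge0\}$ and $y_-:=-y\mathbf 1\{y<0\}$. The drift is $\mu(x):=\mathbb E_x[\theta]$. For $a\ge0$, $\tau_a:=\min\{n\ge0:\xi_n\le a\}$. Recurrence/transience: $\Xi$ is transient if $\xi_n\to\infty$ a.s.; recurrent if $\liminf_n\xi_n\le r_0$ a.s. for some deterministic $r_0\in\mathbb R_+$; positive recurrent if $\mathbb E_x[\tau_a]<\infty$ for all sufficiently large $a$ and all $x$; null recurrent if recurrent and $\mathbb E_x[\tau_a]=\infty$ for all sufficiently large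 $a$ and all $x>a$. Condition (N): $\limsup_{n\to\infty}\xi_n=+\infty$ a.s. Condition $(\mathrm T_{\alpha,\beta,c})$: there exist constants $\alpha\in(1,2)$, $\beta>\alpha$, $c>0$ and $x_0\in\mathbb R_+$ such that $\lim_{y\to\infty}\sup_{x\ge x_0}|y^\alpha\mathbb P_x[\theta_+>y]-c|=0$ and $\sup_{x\ge x_0}\mathbb E_x[\theta_-^\beta]<\infty$. *)

theory Defs
  imports "HOL-Probability.Probability"
begin

text \<open>Trajectory space: streams of reals with the product (cylinder) sigma-algebra.
  A trajectory is omega, and xi_n(omega) = omega !! n.\<close>

abbreviation traj :: "real stream measure" where
  "traj \<equiv> stream_space (borel :: real measure)"

text \<open>A time-homogeneous Markov chain on the state space X (a subset of R_+)
  with transition kernel K; P x is the law of the whole trajectory started at x,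
  i.e. P_x.  The law P x is characterised by: xi_0 = x, xi_1 is distributed as K x,
  and given xi_1 = y the shifted trajectory has law P y.\<close>

definition markov_chain ::
  "real set \<Rightarrow> (real \<Rightarrow> real measure) \<Rightarrow> (real \<Rightarrow> real stream measure) \<Rightarrow> bool" where
  "markov_chain X K P \<longleftrightarrow>
     X \<in> sets borel \<and> X \<subseteq> {0..} \<and> infinite X \<and> \<not> bdd_above X \<and>
     K \<in> measurable borel (prob_algebra borel) \<and>
     (\<forall>x\<in>X. emeasure (K x) X = 1) \<and>
     P \<in> measurable borel (prob_algebra traj) \<and>
     (\<forall>x\<in>X. P x = bind (K x) (\<lambda>y. distr (P y) traj (\<lambda>\<omega>. x ## \<omega>)))"

definition theta :: "real stream \<Rightarrow> real" where
  "theta \<omega> = \<omega> !! 1 - \<omega> !! 0"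

definition pos_part :: "real \<Rightarrow> real" where
  "pos_part y = (if y \<ge> 0 then y else 0)"

definition neg_part :: "real \<Rightarrow> real" where
  "neg_part y = (if y < 0 then - y else 0)"

definition drift :: "(real \<Rightarrow> real stream measure) \<Rightarrow> real \<Rightarrow> real" where
  "drift P x = (\<integral>\<omega>. theta \<omega> \<partial>(P x))"

definition at_top_in :: "real set \<Rightarrow> real filter" where
  "at_top_in X = inf at_top (principal X)"

definition hit_time :: "real \<Rightarrow> real stream \<Rightarrow> ennreal" where
  "hit_time a \<omega> = (if \<exists>n. \<omega> !! n \<le> a then of_nat (LEAST n. \<omega> !! n \<le> a) else \<infinity>)"

definition transient :: "real set \<Rightarrow> (real \<Rightarrow> real stream measure) \<Rightarrow> bool" where
  "transient X P \<longleftrightarrow>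
     (\<forall>x\<in>X. AE \<omega> in P x. filterlim (\<lambda>n. \<omega> !! n) at_top sequentially)"

definition recurrent :: "real set \<Rightarrow> (real \<Rightarrow> real stream measure) \<Rightarrow> bool" where
  "recurrent X P \<longleftrightarrow>
     (\<exists>r0::real. r0 \<ge> 0 \<and> (\<forall>x\<in>X. AE \<omega> in P x. liminf (\<lambda>n. ereal (\<omega> !! n)) \<le> ereal r0))"

definition positive_recurrent :: "real set \<Rightarrow> (real \<Rightarrow> real stream measure) \<Rightarrow> bool" where
  "positive_recurrent X P \<longleftrightarrow>
     (\<exists>a0. \<forall>a\<ge>a0. \<forall>x\<in>X. (\<integral>\<^sup>+ \<omega>. hit_time a \<omega> \<partial>(P x)) < \<infinity>)"

definition cond_N :: "real set \<Rightarrow> (real \<Rightarrow> real stream measure) \<Rightarrow> bool" where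
  "cond_N X P \<longleftrightarrow> (\<forall>x\<in>X. AE \<omega> in P x. limsup (\<lambda>n. ereal (\<omega> !! n)) = \<infinity>)"

definition cond_T ::
  "real set \<Rightarrow> (real \<Rightarrow> real stream measure) \<Rightarrow> real \<Rightarrow> real \<Rightarrow> real \<Rightarrow> real \<Rightarrow> bool" where
  "cond_T X P \<alpha> \<beta> c x0 \<longleftrightarrow>
     1 < \<alpha> \<and> \<alpha> < 2 \<and> \<beta> > \<alpha> \<and> c > 0 \<and> x0 \<ge> 0 \<and>
     (\<forall>\<epsilon>>0. \<exists>Y. \<forall>y\<ge>Y. \<forall>x\<in>X. x \<ge> x0 \<longrightarrow>
        \<bar>y powr \<alpha> * measure (P x) {\<omega> \<in> space traj. pos_part (theta \<omega>) > y} - c\<bar> \<le> \<epsilon>) \<and>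
     (\<exists>B::real. \<forall>x\<in>X. x \<ge> x0 \<longrightarrow>
        (\<integral>\<^sup>+ \<omega>. ennreal (neg_part (theta \<omega>) powr \<beta>) \<partial>(P x)) \<le> ennreal B)"

end

theory Submission
  imports Defs "HOL-Real_Asymp.Real_Asymp"
begin

text \<open>Everything follows from Lyapunov functions \<open>f\<close> with \<open>E\<^sub>x f (\<xi>\<^sub>1) \<le> f x\<close> for large \<open>x\<close>:
  \<open>f x = ln (1 + x)\<close> for recurrence, \<open>f x = 1 / (1 + ln (1 + x))\<close> for transience, and
  \<open>f x = x powr p\<close> with \<open>1 + \<gamma> < p < \<alpha>\<close> for positive recurrence.
  With \<open>z = 1 + x\<close> and \<open>\<phi> u = u - ln (1 + u)\<close> the increment of \<open>ln z\<close> is essentially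
  \<open>\<theta> / z - \<phi> (\<theta>\<^sub>+ / z)\<close>, and the tail asymptotics give
  \<open>E \<phi> (\<theta>\<^sub>+ / z) \<sim> c * z powr - \<alpha> * (\<integral> u powr (1 - \<alpha>) / (1 + u) du)\<close>.  The integral equals
  \<open>\<Gamma> (2 - \<alpha>) * \<Gamma> (\<alpha> - 1) = \<pi> * \<bar>csc (\<pi> * \<alpha>)\<bar>\<close>, which is where the critical constant comes from.
  The hitting estimates need no martingale convergence: one-step analysis and induction on the
  time horizon give the maximal inequalities, and condition (N) supplies the rest.\<close>

text \<open>To leading order the drift of \<open>ln z\<close> is z powr - \<alpha> times z powr
  (\<alpha> - 1) * \<mu> - c * I, with I the integral above, so a strict inequality fixes its sign.
  The decreasing function \<open>1 / (1 + ln z)\<close> inherits the same threshold, because its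
  second-order correction is smaller by a factor of order 1 / ln z. The shift by 1 keeps z +
  \<theta> at least 1: both functions stay nonnegative and the criteria can be phrased with
  \<open>ennreal\<close> integrals. Downward jumps are harmless for recurrence, where concavity
  bounds their effect by the linear term. For transience a jump to the origin can lift
  \<open>1 / (1 + ln z)\<close> up to 1; the moment of order \<beta> > \<alpha> makes the total
  effect o(z powr - \<alpha>). Estimates on the increment are stated for an arbitrary probability
  measure on the line. Where a threshold occurs, it is chosen before the measure, which gives
  uniformity in the starting point.\<close>

lemma space_traj [simp]: "space traj = UNIV"
  by (simp add: space_stream_space)

lemma theta_measurable [measurable]: "theta \<in> borel_measurable traj"
  unfolding theta_def[abs_def] by measurable

lemma neg_part_measurable [measurable]: "neg_part \<in> borel_measurable borel"
  unfolding neg_part_def[abs_def] by measurable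

lemma sets_traj_Collect: "Measurable.pred traj Q \<Longrightarrow> {\<omega>. Q \<omega>} \<in> sets traj"
  by (simp add: pred_def)

section \<open>Lyapunov criteria for Markov chains\<close>

locale chain =
  fixes X :: "real set" and K :: "real \<Rightarrow> real measure" and P :: "real \<Rightarrow> real stream measure"
  assumes markov: "markov_chain X K P"
begin

lemma X_sets [measurable]: "X \<in> sets borel" and X_nonneg: "x \<in> X \<Longrightarrow> 0 \<le> x"
  and K_kernel: "K \<in> measurable borel (prob_algebra borel)"
  and P_kernel: "P \<in> measurable borel (prob_algebra traj)"
  and K_X: "x \<in> X \<Longrightarrow> emeasure (K x) X = 1"
  and P_step: "x \<in> X \<Longrightarrow> P x = bind (K x) (\<lambda>y. distr (P y) traj (\<lambda>\<omega>. x ## \<omega>))"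
  using markov unfolding markov_chain_def by auto

lemma prob_space_K: "prob_space (K x)" and sets_K [measurable_cong, simp]: "sets (K x) = sets borel"
  using measurable_space[OF K_kernel, of x] by (auto simp: space_prob_algebra)

lemma prob_space_P: "prob_space (P x)" and sets_P [measurable_cong, simp]: "sets (P x) = sets traj"
  using measurable_space[OF P_kernel, of x] by (auto simp: space_prob_algebra)

lemma space_P [simp]: "space (P x) = UNIV"
  using sets_eq_imp_space_eq[OF sets_P, of x] by simp

lemma space_K [simp]: "space (K x) = UNIV"
  using sets_eq_imp_space_eq[OF sets_K, of x] by simp

lemma emeasure_P_le_1: "emeasure (P x) A \<le> 1"
  using prob_space_P by (rule prob_space.emeasure_le_1)

section \<open>First-step analysis and the maximal inequalities it yields\<close>

lemma AE_K_X:
  assumes "x \<in> X"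
  shows "AE y in K x. y \<in> X"
proof -
  interpret prob_space "K x" by (rule prob_space_K)
  have "prob X = 1"
    using K_X[OF assms] by (simp add: measure_def)
  then show ?thesis by (rule AE_prob_1)
qed

text \<open>The recursive equation for \<open>P x\<close>, integrated against a nonnegative
  functional. All conditioning below goes through this identity, so neither filtrations nor stopping
  times are introduced.\<close>

lemma nn_integral_P_step:
  assumes x: "x \<in> X" and [measurable]: "F \<in> borel_measurable traj"
  shows "(\<integral>\<^sup>+ \<omega>. F \<omega> \<partial>P x) = (\<integral>\<^sup>+ y. (\<integral>\<^sup>+ \<omega>. F (x ## \<omega>) \<partial>P y) \<partial>K x)"
proof -
  have P: "P \<in> measurable (K x) (subprob_algebra traj)"
    using measurable_prob_algebraD[OF P_kernel] by (simp cong: measurable_cong_sets)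
  have "(\<lambda>y. distr (P y) traj (\<lambda>\<omega>. x ## \<omega>)) \<in> measurable (K x) (subprob_algebra traj)"
    by (rule measurable_compose[OF P measurable_distr]) measurable
  then show ?thesis
    by (subst P_step[OF x], subst nn_integral_bind[where B=traj]) (auto intro!: nn_integral_cong nn_integral_distr)
qed

lemma emeasure_P_step:
  assumes x: "x \<in> X" and Q: "{\<omega>. Q \<omega>} \<in> sets traj"
  shows "emeasure (P x) {\<omega>. Q \<omega>} = (\<integral>\<^sup>+ y. emeasure (P y) {\<omega>. Q (x ## \<omega>)} \<partial>K x)"
proof -
  have Q': "Measurable.pred traj Q" using Q by (simp add: pred_def)
  have "Measurable.pred traj (\<lambda>\<omega>. Q (x ## \<omega>))"
    by (rule measurable_compose[OF _ Q']) measurable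
  then have S: "{\<omega>. Q (x ## \<omega>)} \<in> sets traj" by (simp add: pred_def)
  have "emeasure (P x) {\<omega>. Q \<omega>} = (\<integral>\<^sup>+ \<omega>. indicator {\<omega>. Q \<omega>} \<omega> \<partial>P x)"
    using Q by simp
  also have "\<dots> = (\<integral>\<^sup>+ y. (\<integral>\<^sup>+ \<omega>. indicator {\<omega>. Q \<omega>} (x ## \<omega>) \<partial>P y) \<partial>K x)"
    by (rule nn_integral_P_step[OF x]) (use Q in measurable)
  also have "\<dots> = (\<integral>\<^sup>+ y. (\<integral>\<^sup>+ \<omega>. indicator {\<omega>. Q (x ## \<omega>)} \<omega> \<partial>P y) \<partial>K x)"
    by (simp add: indicator_def)
  also have "\<dots> = (\<integral>\<^sup>+ y. emeasure (P y) {\<omega>. Q (x ## \<omega>)} \<partial>K x)"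
    using S by simp
  finally show ?thesis .
qed

text \<open>Induction step of the hitting estimates: a bound of the shifted event by
  \<open>f\<close> on \<open>X\<close> is carried back one step by the supermartingale inequality at
  \<open>x\<close>. Bounds on \<open>X\<close> suffice since \<open>K x\<close> is concentrated
  there.\<close>

lemma emeasure_P_step_le:
  assumes x: "x \<in> X" and Q: "{\<omega>. Q \<omega>} \<in> sets traj"
    and le: "\<And>y. y \<in> X \<Longrightarrow> emeasure (P y) {\<omega>. Q (x ## \<omega>)} \<le> f y"
    and f: "(\<integral>\<^sup>+ y. f y \<partial>K x) \<le> f x"
  shows "emeasure (P x) {\<omega>. Q \<omega>} \<le> f x"
proof -
  have "emeasure (P x) {\<omega>. Q \<omega>} \<le> (\<integral>\<^sup>+ y. f y \<partial>K x)"
    unfolding emeasure_P_step[OF x Q]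
    by (rule nn_integral_mono_AE) (use AE_K_X[OF x] le in auto)
  then show ?thesis using f by simp
qed

lemma AE_P_iff:
  assumes "{\<omega>. Q \<omega>} \<in> sets traj"
  shows "(AE \<omega> in P x. Q \<omega>) \<longleftrightarrow> emeasure (P x) {\<omega>. \<not> Q \<omega>} = 0"
proof -
  have "Measurable.pred traj Q" using assms by (simp add: pred_def)
  then have "Measurable.pred traj (\<lambda>\<omega>. \<not> Q \<omega>)" by measurable
  then have "{\<omega>. \<not> Q \<omega>} \<in> sets traj" by (simp add: pred_def)
  then show ?thesis
    by (subst AE_iff_measurable[OF _ refl]) auto
qed

text \<open>After one step the path has the form \<open>x ## \<omega>\<close>, whose head is
  \<open>x\<close> by construction, so the exceptional event has empty sections.\<close>

lemma AE_P_head: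
  assumes x: "x \<in> X"
  shows "AE \<omega> in P x. \<omega> !! 0 = x"
proof -
  have m: "Measurable.pred traj (\<lambda>\<omega>. \<omega> !! 0 = x)" by measurable
  have m': "Measurable.pred traj (\<lambda>\<omega>. \<not> (\<omega> !! 0 = x))" by measurable
  have "emeasure (P x) {\<omega>. \<not> (\<omega> !! 0 = x)} = 0"
    using m' by (subst emeasure_P_step[OF x]) (simp_all add: pred_def)
  then show ?thesis using m by (subst AE_P_iff) (simp_all add: pred_def)
qed

lemma emeasure_P_head_eq_0:
  assumes x: "x \<in> X" and Q: "\<And>\<omega>. \<omega> !! 0 = x \<Longrightarrow> \<not> Q \<omega>"
  shows "emeasure (P x) {\<omega>. Q \<omega>} = 0"
proof -
  have "AE \<omega> in P x. \<not> Q \<omega>"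
    using AE_P_head[OF x] by (rule AE_mp) (use Q in auto)
  then show ?thesis using emeasure_eq_0_AE[of Q "P x"] by simp
qed

text \<open>Links the hypotheses, which speak of \<open>theta\<close> under \<open>P x\<close>, with
  the Lyapunov inequalities, which speak of \<open>K x\<close>.\<close>

lemma distr_theta:
  assumes x: "x \<in> X"
  shows "distr (P x) borel theta = distr (K x) borel (\<lambda>y. y - x)"
proof (rule measure_eqI)
  fix A assume "A \<in> sets (distr (P x) borel theta)"
  then have A[measurable]: "A \<in> sets borel" by simp
  have "emeasure (distr (P x) borel theta) A = (\<integral>\<^sup>+ \<omega>. indicator A (theta \<omega>) \<partial>P x)"
    by (subst nn_integral_indicator[symmetric]) (simp_all add: nn_integral_distr del: nn_integral_indicator)
  also have "\<dots> = (\<integral>\<^sup>+ y. (\<integral>\<^sup>+ \<omega>. indicator A (theta (x ## \<omega>)) \<partial>P y) \<partial>K x)"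
    by (rule nn_integral_P_step[OF x]) measurable
  also have "\<dots> = (\<integral>\<^sup>+ y. indicator A (y - x) \<partial>K x)"
  proof (rule nn_integral_cong_AE, rule AE_mp[OF AE_K_X[OF x]], rule AE_I2, rule impI)
    fix y assume y: "y \<in> X"
    interpret prob_space "P y" by (rule prob_space_P)
    \<comment> \<open>\<open>theta (x ## \<omega>)\<close> depends on \<open>\<omega>\<close> only
      through its head, which is \<open>y\<close> almost surely under \<open>P y\<close>.\<close>
    have "(\<integral>\<^sup>+ \<omega>. indicator A (theta (x ## \<omega>)) \<partial>P y) = (\<integral>\<^sup>+ \<omega>. indicator A (y - x) \<partial>P y)"
      by (rule nn_integral_cong_AE, rule AE_mp[OF AE_P_head[OF y]]) (auto simp: theta_def)
    then show "(\<integral>\<^sup>+ \<omega>. indicator A (theta (x ## \<omega>)) \<partial>P y) = indicator A (y - x)"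
      by (simp only: nn_integral_const emeasure_space_1 mult_1_right)
  qed
  also have "\<dots> = emeasure (distr (K x) borel (\<lambda>y. y - x)) A"
    by (subst nn_integral_indicator[symmetric]) (simp_all add: nn_integral_distr del: nn_integral_indicator)
  finally show "emeasure (distr (P x) borel theta) A = emeasure (distr (K x) borel (\<lambda>y. y - x)) A" .
qed simp

text \<open>Doob's bound for a nonnegative supermartingale stopped on leaving (A, \<infinity>). For
  \<open>x > R\<close> the right-hand side is at least 1 by monotonicity, for
  \<open>x \<le> A\<close> the event is null, and in between one step lowers the horizon
  \<open>n\<close>. Continuity from below removes the horizon.\<close>

lemma maximal_inequality:
  fixes f :: "real \<Rightarrow> ennreal"
  assumes [measurable]: "f \<in> borel_measurable borel" and f: "mono f"
    and super: "\<And>x. x \<in> X \<Longrightarrow> A < x \<Longrightarrow> (\<integral>\<^sup>+ y. f y \<partial>K x) \<le> f x"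
    and R: "0 < f R" "f R < \<infinity>" and x: "x \<in> X"
  shows "emeasure (P x) {\<omega>. \<exists>n. \<omega> !! n > R \<and> (\<forall>j\<le>n. \<omega> !! j > A)} \<le> f x / f R"
proof -
  define Q where "Q n \<omega> \<longleftrightarrow> (\<exists>m\<le>n. \<omega> !! m > R \<and> (\<forall>j\<le>m. \<omega> !! j > A))" for n :: nat and \<omega>
  have Qm: "{\<omega>. Q n \<omega>} \<in> sets traj" for n
    unfolding Q_def by (rule sets_traj_Collect) measurable
  have "emeasure (P x) {\<omega>. Q n \<omega>} \<le> f x / f R" if "x \<in> X" for x n
    using that
  proof (induction n arbitrary: x)
    case (0 x)
    show ?case
    proof (cases "x > R")
      case True
      then have "f R \<le> f x" using f by (auto intro: monoD)
      then have "1 \<le> f x / f R"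
        using R by (metis divide_right_mono_ennreal ennreal_divide_self infinity_ennreal_def less_irrefl)
      then show ?thesis using emeasure_P_le_1[of x "{\<omega>. Q 0 \<omega>}"] by (rule order_trans[rotated])
    next
      case False
      have "emeasure (P x) {\<omega>. Q 0 \<omega>} = 0"
        by (rule emeasure_P_head_eq_0[OF 0]) (use False in \<open>auto simp: Q_def\<close>)
      then show ?thesis by simp
    qed
  next
    case (Suc n x)
    consider "x > R" | "x \<le> A" | "A < x" "x \<le> R" by linarith
    then show ?case
    proof cases
      case 1
      then have "f R \<le> f x" using f by (auto intro: monoD)
      then have "1 \<le> f x / f R"
        using R by (metis divide_right_mono_ennreal ennreal_divide_self infinity_ennreal_def less_irrefl)
      then show ?thesis using emeasure_P_le_1 by (rule order_trans[rotated])
    next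
      case 2
      have "emeasure (P x) {\<omega>. Q (Suc n) \<omega>} = 0"
        by (rule emeasure_P_head_eq_0[OF Suc.prems]) (use 2 in \<open>force simp: Q_def\<close>)
      then show ?thesis by simp
    next
      case 3
      have eq: "Q (Suc n) (x ## \<omega>) = Q n \<omega>" for \<omega>
        unfolding Q_def All_less_Suc2 less_Suc_eq_le[symmetric] Ex_less_Suc2 using 3 by simp
      show ?thesis
      proof (rule emeasure_P_step_le[OF Suc.prems Qm, where f = "\<lambda>y. f y / f R"])
        show "emeasure (P y) {\<omega>. Q (Suc n) (x ## \<omega>)} \<le> f y / f R" if "y \<in> X" for y
          using Suc.IH[OF that] by (simp add: eq)
        show "(\<integral>\<^sup>+ y. f y / f R \<partial>K x) \<le> f x / f R"
          using super[OF Suc.prems 3(1)] by (simp add: nn_integral_divide divide_right_mono_ennreal)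
      qed
    qed
  qed
  then have "(SUP n. emeasure (P x) {\<omega>. Q n \<omega>}) \<le> f x / f R"
    using x by (intro SUP_least)
  also have "(SUP n. emeasure (P x) {\<omega>. Q n \<omega>}) = emeasure (P x) (\<Union>n. {\<omega>. Q n \<omega>})"
    using Qm by (intro SUP_emeasure_incseq) (auto simp: incseq_def Q_def intro: order_trans)
  also have "(\<Union>n. {\<omega>. Q n \<omega>}) = {\<omega>. \<exists>n. \<omega> !! n > R \<and> (\<forall>j\<le>n. \<omega> !! j > A)}"
    by (auto simp: Q_def)
  finally show ?thesis .
qed


text \<open>The counterpart for decreasing \<open>f\<close> with a single barrier: up to
  \<open>A\<close> the quotient is at least 1, above \<open>A\<close> one step is taken. The bound
  is small for distant starts when \<open>f\<close> vanishes at infinity.\<close>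

lemma return_inequality:
  fixes f :: "real \<Rightarrow> ennreal"
  assumes [measurable]: "f \<in> borel_measurable borel" and f: "antimono f"
    and super: "\<And>x. x \<in> X \<Longrightarrow> A < x \<Longrightarrow> (\<integral>\<^sup>+ y. f y \<partial>K x) \<le> f x"
    and A: "0 < f A" "f A < \<infinity>" and x: "x \<in> X"
  shows "emeasure (P x) {\<omega>. \<exists>n. \<omega> !! n \<le> A} \<le> f x / f A"
proof -
  define Q where "Q n \<omega> \<longleftrightarrow> (\<exists>m\<le>n. \<omega> !! m \<le> A)" for n :: nat and \<omega>
  have Qm: "{\<omega>. Q n \<omega>} \<in> sets traj" for n
    unfolding Q_def by (rule sets_traj_Collect) measurable
  have low: "emeasure (P x) S \<le> f x / f A" if "x \<le> A" for x S
  proof -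
    have "f A \<le> f x" using f that by (auto intro: antimonoD)
    then have "1 \<le> f x / f A"
      using A by (metis divide_right_mono_ennreal ennreal_divide_self infinity_ennreal_def less_irrefl)
    then show ?thesis using emeasure_P_le_1 by (rule order_trans[rotated])
  qed
  have "emeasure (P x) {\<omega>. Q n \<omega>} \<le> f x / f A" if "x \<in> X" for x n
    using that
  proof (induction n arbitrary: x)
    case (0 x)
    show ?case
    proof (cases "x \<le> A")
      case False
      have "emeasure (P x) {\<omega>. Q 0 \<omega>} = 0"
        by (rule emeasure_P_head_eq_0[OF 0]) (use False in \<open>auto simp: Q_def\<close>)
      then show ?thesis by simp
    qed (rule low)
  next
    case (Suc n x)
    show ?case
    proof (cases "x \<le> A")
      case False
      have eq: "Q (Suc n) (x ## \<omega>) = Q n \<omega>" for \<omega>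
        unfolding Q_def less_Suc_eq_le[symmetric] Ex_less_Suc2 using False by simp
      show ?thesis
      proof (rule emeasure_P_step_le[OF Suc.prems Qm, where f = "\<lambda>y. f y / f A"])
        show "emeasure (P y) {\<omega>. Q (Suc n) (x ## \<omega>)} \<le> f y / f A" if "y \<in> X" for y
          using Suc.IH[OF that] by (simp add: eq)
        show "(\<integral>\<^sup>+ y. f y / f A \<partial>K x) \<le> f x / f A"
          using super[OF Suc.prems] False by (simp add: nn_integral_divide divide_right_mono_ennreal)
      qed
    qed (rule low)
  qed
  then have "(SUP n. emeasure (P x) {\<omega>. Q n \<omega>}) \<le> f x / f A"
    using x by (intro SUP_least)
  also have "(SUP n. emeasure (P x) {\<omega>. Q n \<omega>}) = emeasure (P x) (\<Union>n. {\<omega>. Q n \<omega>})"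
    using Qm by (intro SUP_emeasure_incseq) (auto simp: incseq_def Q_def intro: order_trans)
  also have "(\<Union>n. {\<omega>. Q n \<omega>}) = {\<omega>. \<exists>n. \<omega> !! n \<le> A}"
    by (auto simp: Q_def)
  finally show ?thesis .
qed

section \<open>Criteria for recurrence, transience and finite mean hitting times\<close>

lemma cond_N_exceeds:
  assumes N: "cond_N X P" and x: "x \<in> X"
  shows "AE \<omega> in P x. \<exists>n. \<omega> !! n > R"
proof -
  have "AE \<omega> in P x. limsup (\<lambda>n. ereal (\<omega> !! n)) = \<infinity>"
    using N x by (simp add: cond_N_def)
  then show ?thesis
  proof (rule AE_mp, intro AE_I2 impI)
    fix \<omega> assume "limsup (\<lambda>n. ereal (\<omega> !! n)) = \<infinity>"
    moreover have "limsup (\<lambda>n. ereal (\<omega> !! n)) \<le> ereal R" if "\<And>n. \<omega> !! n \<le> R"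
      by (rule Limsup_bounded) (use that in auto)
    ultimately show "\<exists>n. \<omega> !! n > R" by (metis infinity_ereal_def not_le ereal_infty_less_eq(1) ereal.distinct(1))
  qed
qed

text \<open>By (N), a path that never drops to \<open>A\<close> crosses every level \<open>R\<close>
  while staying above \<open>A\<close>. This has probability at most \<open>f x / f R\<close>, which
  vanishes as \<open>R\<close> grows. Applying the result from every later time gives infinitely
  many visits.\<close>

lemma recurrent_criterion:
  fixes f :: "real \<Rightarrow> ennreal"
  assumes N: "cond_N X P" and fm: "f \<in> borel_measurable borel" and f: "mono f" and fin: "\<And>x. f x < \<infinity>"
    and top: "(f \<longlongrightarrow> \<infinity>) at_top" and "0 \<le> A"
    and super: "\<And>x. x \<in> X \<Longrightarrow> A < x \<Longrightarrow> (\<integral>\<^sup>+ y. f y \<partial>K x) \<le> f x"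
  shows "recurrent X P"
proof -
  have ret: "AE \<omega> in P x. \<exists>n. \<omega> !! n \<le> A" if x: "x \<in> X" for x
  proof -
    have m: "{\<omega>. \<exists>n. \<omega> !! n \<le> A} \<in> sets traj"
      by (rule sets_traj_Collect) measurable
    have m2: "{\<omega>. \<exists>n. \<omega> !! n > R \<and> (\<forall>j\<le>n. \<omega> !! j > A)} \<in> sets traj" for R
      by (rule sets_traj_Collect) measurable
    have le: "emeasure (P x) {\<omega>. \<not> (\<exists>n. \<omega> !! n \<le> A)} \<le> f x / f R" if R: "0 < f R" for R
    proof -
      have "emeasure (P x) {\<omega>. \<not> (\<exists>n. \<omega> !! n \<le> A)}
          \<le> emeasure (P x) {\<omega>. \<exists>n. \<omega> !! n > R \<and> (\<forall>j\<le>n. \<omega> !! j > A)}"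
        by (rule emeasure_mono_AE, rule AE_mp[OF cond_N_exceeds[OF N x, of R]]) (use m2 in \<open>auto simp: not_le\<close>)
      also have "\<dots> \<le> f x / f R"
        by (rule maximal_inequality[OF fm f super R fin x])
      finally show ?thesis .
    qed
    \<comment> \<open>Multiplication in \<open>ennreal\<close> is discontinuous at 0 * \<infinity>;
      the quotient is therefore split into the fixed finite factor \<open>f x\<close> and the
      continuous inverse.\<close>
    have "((\<lambda>R. f x * inverse (f R)) \<longlongrightarrow> f x * inverse \<infinity>) at_top"
    proof (rule ennreal_tendsto_cmult)
      show "((\<lambda>R. inverse (f R)) \<longlongrightarrow> inverse \<infinity>) at_top"
        by (rule continuous_on_tendsto_compose[OF continuous_on_inverse_ennreal[OF continuous_on_id, of UNIV] top]) auto
    qed (use fin[of x] in simp)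
    then have lim: "((\<lambda>R. f x / f R) \<longlongrightarrow> 0) at_top"
      by (simp add: divide_ennreal_def)
    have "eventually (\<lambda>R. 0 < f R) at_top"
      by (rule order_tendstoD[OF top]) simp
    then have "eventually (\<lambda>R. emeasure (P x) {\<omega>. \<not> (\<exists>n. \<omega> !! n \<le> A)} \<le> f x / f R) at_top"
      by (rule eventually_mono) (rule le)
    then have "emeasure (P x) {\<omega>. \<not> (\<exists>n. \<omega> !! n \<le> A)} \<le> 0"
      using lim by (intro tendsto_lowerbound) auto
    then show ?thesis using m by (subst AE_P_iff) auto
  qed
  \<comment> \<open>Removing the initial state lowers the time bound \<open>N\<close> by one, so the
    almost sure return from all starts in \<open>X\<close> extends to all later times.\<close>
  have ret_late: "AE \<omega> in P x. \<exists>n\<ge>N. \<omega> !! n \<le> A" if "x \<in> X" for x N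
    using that
  proof (induction N arbitrary: x)
    case 0
    then show ?case using ret by simp
  next
    case (Suc N)
    have m: "{\<omega>. \<exists>n\<ge>N. \<omega> !! n \<le> A} \<in> sets traj" for N
      by (rule sets_traj_Collect) measurable
    have m': "{\<omega>. \<not> (\<exists>n\<ge>N. \<omega> !! n \<le> A)} \<in> sets traj" for N
      by (rule sets_traj_Collect) measurable
    have eq: "(\<exists>n\<ge>Suc N. (x ## \<omega>) !! n \<le> A) = (\<exists>n\<ge>N. \<omega> !! n \<le> A)" for \<omega>
      by (metis Suc_le_D Suc_le_mono snth_Stream stream.sel(2) snth.simps(2))
    have "emeasure (P x) {\<omega>. \<not> (\<exists>n\<ge>Suc N. \<omega> !! n \<le> A)} \<le> 0"
      by (rule emeasure_P_step_le[OF Suc.prems m', where f = "\<lambda>_. 0"])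
         (use Suc.IH m in \<open>auto simp only: eq AE_P_iff nn_integral_const mult_zero_left\<close>)
    then show ?case using m by (subst AE_P_iff) auto
  qed
  show ?thesis
    unfolding recurrent_def
  proof (intro exI[of _ A] conjI ballI)
    fix x assume "x \<in> X"
    then have "AE \<omega> in P x. \<forall>N. \<exists>n\<ge>N. \<omega> !! n \<le> A"
      using ret_late by (simp add: AE_all_countable)
    then show "AE \<omega> in P x. liminf (\<lambda>n. ereal (\<omega> !! n)) \<le> ereal A"
    proof (rule AE_mp, intro AE_I2 impI)
      fix \<omega> assume *: "\<forall>N. \<exists>n\<ge>N. \<omega> !! n \<le> A"
      show "liminf (\<lambda>n. ereal (\<omega> !! n)) \<le> ereal A"
      proof (rule ccontr)
        assume "\<not> ?thesis"
        then have "eventually (\<lambda>n. ereal A < ereal (\<omega> !! n)) sequentially"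
          by (intro less_LiminfD) auto
        then show False using * by (auto simp: eventually_sequentially) (meson not_le)
      qed
    qed
  qed fact
qed

text \<open>Infinitely many visits to (-\<infinity>, B] form a shift-invariant event
  \<open>G B\<close>. Started beyond \<open>R\<close> it has probability at most
  \<open>f R / f B\<close> by the return inequality; (N) takes the chain beyond \<open>R\<close>
  from any start, and shift invariance carries the bound back. Letting \<open>R\<close> grow gives
  probability 0.\<close>

lemma transient_criterion:
  fixes f :: "real \<Rightarrow> ennreal"
  assumes N: "cond_N X P" and fm: "f \<in> borel_measurable borel" and f: "antimono f" and pos: "\<And>x. 0 < f x" and fin: "\<And>x. f x < \<infinity>"
    and top: "(f \<longlongrightarrow> 0) at_top"
    and super: "\<And>x. x \<in> X \<Longrightarrow> A < x \<Longrightarrow> (\<integral>\<^sup>+ y. f y \<partial>K x) \<le> f x"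
  shows "transient X P"
proof -
  define G where "G B \<omega> \<longleftrightarrow> (\<forall>N. \<exists>n\<ge>N. \<omega> !! n \<le> B)" for B :: real and \<omega>
  have Gm [measurable]: "Measurable.pred traj (G B)" for B
    unfolding G_def by measurable
  have Gshift: "G B (x ## \<omega>) = G B \<omega>" for B x \<omega>
  proof
    assume *: "G B (x ## \<omega>)"
    show "G B \<omega>"
      unfolding G_def
    proof
      fix N
      obtain n where "n \<ge> Suc N" "(x ## \<omega>) !! n \<le> B" using * by (auto simp: G_def)
      then show "\<exists>n\<ge>N. \<omega> !! n \<le> B" by (cases n) auto
    qed
  next
    assume *: "G B \<omega>"
    show "G B (x ## \<omega>)"
      unfolding G_def
    proof
      fix N
      obtain n where "n \<ge> N" "\<omega> !! n \<le> B" using * by (auto simp: G_def)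
      then show "\<exists>n\<ge>N. (x ## \<omega>) !! n \<le> B" by (intro exI[of _ "Suc n"]) auto
    qed
  qed
  have zero: "AE \<omega> in P x. \<not> G B \<omega>" if x: "x \<in> X" and B: "A \<le> B" for x B
  proof -
    have far: "emeasure (P y) {\<omega>. G B \<omega>} \<le> f R / f B" if "y \<in> X" "R < y" for y R
    proof -
      have "Measurable.pred traj (\<lambda>\<omega>. \<exists>n. \<omega> !! n \<le> B)" by measurable
      then have "emeasure (P y) {\<omega>. G B \<omega>} \<le> emeasure (P y) {\<omega>. \<exists>n. \<omega> !! n \<le> B}"
        by (intro emeasure_mono) (auto simp: G_def pred_def)
      also have "\<dots> \<le> f y / f B"
        by (rule return_inequality[OF fm f super pos fin]) (use B that in auto)
      also have "\<dots> \<le> f R / f B"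
        using that f by (intro divide_right_mono_ennreal) (auto intro: antimonoD)
      finally show ?thesis .
    qed
    \<comment> \<open>Stands in for the strong Markov property at the crossing of \<open>R\<close>:
      constants are trivially supermartingales, so the bound valid beyond \<open>R\<close>
      propagates back over any finite horizon.\<close>
    have reach: "emeasure (P x) {\<omega>. G B \<omega> \<and> (\<exists>m\<le>n. \<omega> !! m > R)} \<le> f R / f B" if "x \<in> X" for x n R
      using that
    proof (induction n arbitrary: x)
      case (0 x)
      have m: "{\<omega>. G B \<omega> \<and> (\<exists>m\<le>0. \<omega> !! m > R)} \<in> sets traj"
        by (rule sets_traj_Collect) measurable
      show ?case
      proof (cases "x > R")
        case True
        have "emeasure (P x) {\<omega>. G B \<omega> \<and> (\<exists>m\<le>0. \<omega> !! m > R)} \<le> emeasure (P x) {\<omega>. G B \<omega>}"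
          using Gm by (intro emeasure_mono) (auto simp: pred_def)
        then show ?thesis using far[OF 0 True] by simp
      next
        case False
        have "emeasure (P x) {\<omega>. G B \<omega> \<and> (\<exists>m\<le>0. \<omega> !! m > R)} = 0"
          by (rule emeasure_P_head_eq_0[OF 0]) (use False in auto)
        then show ?thesis by simp
      qed
    next
      case (Suc n x)
      show ?case
      proof (cases "x > R")
        case True
        have "emeasure (P x) {\<omega>. G B \<omega> \<and> (\<exists>m\<le>Suc n. \<omega> !! m > R)} \<le> emeasure (P x) {\<omega>. G B \<omega>}"
          using Gm by (intro emeasure_mono) (auto simp: pred_def)
        then show ?thesis using far[OF Suc.prems True] by simp
      next
        case False
        have m: "{\<omega>. G B \<omega> \<and> (\<exists>m\<le>Suc n. \<omega> !! m > R)} \<in> sets traj"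
          by (rule sets_traj_Collect) measurable
        have eq: "(\<exists>m\<le>Suc n. (x ## \<omega>) !! m > R) = (\<exists>m\<le>n. \<omega> !! m > R)" for \<omega>
          unfolding less_Suc_eq_le[symmetric] Ex_less_Suc2 using False by simp
        interpret prob_space "K x" by (rule prob_space_K)
        show ?thesis
          by (rule emeasure_P_step_le[OF Suc.prems m, where f = "\<lambda>_. f R / f B"])
             (use Suc.IH emeasure_space_1 in \<open>auto simp: eq Gshift simp del: space_K\<close>)
      qed
    qed
    have bound: "emeasure (P x) {\<omega>. G B \<omega>} \<le> f R / f B" for R
    proof -
      define Q where "Q n \<omega> \<longleftrightarrow> G B \<omega> \<and> (\<exists>m\<le>n. \<omega> !! m > R)" for n :: nat and \<omega>
      have "Measurable.pred traj (Q n)" for n unfolding Q_def by measurable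
      then have Qm: "{\<omega>. Q n \<omega>} \<in> sets traj" for n by (simp add: pred_def)
      then have Um: "(\<Union>n. {\<omega>. Q n \<omega>}) \<in> sets traj" by auto
      have "emeasure (P x) {\<omega>. G B \<omega>} \<le> emeasure (P x) (\<Union>n. {\<omega>. Q n \<omega>})"
        by (rule emeasure_mono_AE, rule AE_mp[OF cond_N_exceeds[OF N x, of R]])
           (use Um in \<open>auto simp: Q_def\<close>)
      also have "\<dots> = (SUP n. emeasure (P x) {\<omega>. Q n \<omega>})"
        using Qm by (intro SUP_emeasure_incseq[symmetric]) (auto simp: incseq_def Q_def intro: order_trans)
      also have "\<dots> \<le> f R / f B"
        using reach[OF x] by (intro SUP_least) (simp add: Q_def)
      finally show ?thesis .
    qed
    \<comment> \<open>Positivity of \<open>f B\<close> makes the factor \<open>inverse (f B)\<close>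
      finite, so the limit may be taken inside the product.\<close>
    have "((\<lambda>R. inverse (f B) * f R) \<longlongrightarrow> inverse (f B) * 0) at_top"
      using pos[of B] top by (intro ennreal_tendsto_cmult) (auto simp: ennreal_inverse_eq_top_iff less_top[symmetric])
    then have lim: "((\<lambda>R. f R / f B) \<longlongrightarrow> 0) at_top"
      by (simp add: divide_ennreal_def mult.commute)
    have "emeasure (P x) {\<omega>. G B \<omega>} \<le> 0"
      using bound lim by (intro tendsto_lowerbound[OF lim]) auto
    moreover have "Measurable.pred traj (\<lambda>\<omega>. \<not> G B \<omega>)" by measurable
    ultimately show ?thesis by (subst AE_P_iff) (auto simp: pred_def)
  qed
  show ?thesis
    unfolding transient_def
  proof
    fix x assume x: "x \<in> X"
    \<comment> \<open>Countably many levels exhaust the line, so the null sets can be united; the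
      maximum with \<open>A\<close> meets the condition under which \<open>zero\<close>
      holds.\<close>
    have "AE \<omega> in P x. \<forall>k::nat. \<not> G (max A (real k)) \<omega>"
      using zero[OF x] by (simp add: AE_all_countable)
    then show "AE \<omega> in P x. filterlim (\<lambda>n. \<omega> !! n) at_top sequentially"
    proof (rule AE_mp, intro AE_I2 impI)
      fix \<omega> assume *: "\<forall>k::nat. \<not> G (max A (real k)) \<omega>"
      show "filterlim (\<lambda>n. \<omega> !! n) at_top sequentially"
        unfolding filterlim_at_top eventually_sequentially
      proof
        fix Z :: real
        obtain k :: nat where k: "Z \<le> real k" using real_arch_simple by blast
        obtain N where "\<And>n. n \<ge> N \<Longrightarrow> \<omega> !! n > max A (real k)"
          using *[rule_format, of k] unfolding G_def by (meson not_le)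
        then show "\<exists>N. \<forall>n\<ge>N. Z \<le> \<omega> !! n" using k by (intro exI[of _ N]) force
      qed
    qed
  qed
qed

text \<open>Foster's criterion. The hitting time is the sum of the indicators \<open>s k\<close> of
  not having reached \<open>a\<close> by time \<open>k\<close>; the expected partial sums satisfy a
  one-step recursion of which \<open>f\<close> is a supersolution.\<close>

lemma expected_hit_time_le:
  fixes f :: "real \<Rightarrow> ennreal"
  assumes [measurable]: "f \<in> borel_measurable borel"
    and super: "\<And>x. x \<in> X \<Longrightarrow> a < x \<Longrightarrow> 1 + (\<integral>\<^sup>+ y. f y \<partial>K x) \<le> f x" and x: "x \<in> X"
  shows "(\<integral>\<^sup>+ \<omega>. hit_time a \<omega> \<partial>P x) \<le> f x"
proof -
  define s :: "nat \<Rightarrow> real stream \<Rightarrow> ennreal"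
    where "s k \<omega> = (if \<forall>m\<le>k. \<omega> !! m > a then 1 else 0)" for k \<omega>
  have [measurable]: "s k \<in> borel_measurable traj" for k
    unfolding s_def by measurable
  have s_Stream: "s (Suc k) (x ## \<omega>) = s k \<omega>" if "a < x" for x \<omega> k
    unfolding s_def less_Suc_eq_le[symmetric] All_less_Suc2 using that by simp
  have bound: "(\<integral>\<^sup>+ \<omega>. (\<Sum>k<n. s k \<omega>) \<partial>P x) \<le> f x" if "x \<in> X" for n x
    using that
  proof (induction n arbitrary: x)
    case (Suc n x)
    show ?case
    proof (cases "a < x")
      case False
      have "(\<integral>\<^sup>+ \<omega>. (\<Sum>k<Suc n. s k \<omega>) \<partial>P x) = (\<integral>\<^sup>+ \<omega>. 0 \<partial>P x)"
      proof (rule nn_integral_cong_AE, rule AE_mp[OF AE_P_head[OF Suc.prems]], rule AE_I2, rule impI)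
        fix \<omega> assume "\<omega> !! 0 = x"
        then have "s k \<omega> = 0" for k using False by (force simp: s_def)
        then show "(\<Sum>k<Suc n. s k \<omega>) = 0" by simp
      qed
      then show ?thesis by simp
    next
      case True
      \<comment> \<open>Above \<open>a\<close> the term for time 0 equals 1, and the others are
        those of the shifted path.\<close>
      have *: "(\<Sum>k<Suc n. s k (x ## \<omega>)) = 1 + (\<Sum>k<n. s k \<omega>)" for \<omega>
        unfolding sum.lessThan_Suc_shift s_Stream[OF True] using True by (simp add: s_def)
      have "(\<integral>\<^sup>+ \<omega>. (\<Sum>k<Suc n. s k \<omega>) \<partial>P x) = (\<integral>\<^sup>+ y. (\<integral>\<^sup>+ \<omega>. (\<Sum>k<Suc n. s k (x ## \<omega>)) \<partial>P y) \<partial>K x)"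
        by (rule nn_integral_P_step[OF Suc.prems]) measurable
      also have "\<dots> \<le> (\<integral>\<^sup>+ y. 1 + f y \<partial>K x)"
      proof (rule nn_integral_mono_AE, rule AE_mp[OF AE_K_X[OF Suc.prems]], rule AE_I2, rule impI)
        fix y assume y: "y \<in> X"
        have "(\<integral>\<^sup>+ \<omega>. (\<Sum>k<Suc n. s k (x ## \<omega>)) \<partial>P y) = (\<integral>\<^sup>+ \<omega>. 1 \<partial>P y) + (\<integral>\<^sup>+ \<omega>. (\<Sum>k<n. s k \<omega>) \<partial>P y)"
          unfolding * by (rule nn_integral_add) auto
        also have "(\<integral>\<^sup>+ \<omega>. 1 \<partial>P y) = 1"
          using prob_space.emeasure_space_1[OF prob_space_P, of y] by simp
        finally show "(\<integral>\<^sup>+ \<omega>. (\<Sum>k<Suc n. s k (x ## \<omega>)) \<partial>P y) \<le> 1 + f y"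
          using Suc.IH[OF y] by (simp add: add_left_mono)
      qed
      also have "\<dots> = (\<integral>\<^sup>+ y. 1 \<partial>K x) + (\<integral>\<^sup>+ y. f y \<partial>K x)"
        by (rule nn_integral_add) auto
      also have "(\<integral>\<^sup>+ y. 1 \<partial>K x) = 1"
        using prob_space.emeasure_space_1[OF prob_space_K, of x] by simp
      finally show ?thesis using super[OF Suc.prems True] by (rule order_trans)
    qed
  qed simp
  \<comment> \<open>Bounding by the measurable supremum lets monotonicity of the integral apply
    without a measurability proof for \<open>hit_time a\<close>.\<close>
  have "hit_time a \<omega> \<le> (SUP n. \<Sum>k<n. s k \<omega>)" for \<omega>
  proof (cases "\<exists>n. \<omega> !! n \<le> a")
    case True
    define N where "N = (LEAST n. \<omega> !! n \<le> a)"
    have "\<omega> !! m > a" if "m < N" for m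
      using not_less_Least[of m "\<lambda>n. \<omega> !! n \<le> a"] that by (auto simp: N_def)
    then have "(\<Sum>k<N. s k \<omega>) = (\<Sum>k<N. 1)"
      by (intro sum.cong) (auto simp: s_def)
    moreover have "(\<Sum>k<N. s k \<omega>) \<le> (SUP n. \<Sum>k<n. s k \<omega>)" by (rule SUP_upper) simp
    ultimately show ?thesis using True by (simp add: hit_time_def N_def)
  next
    case False
    then have "(\<Sum>k<n. s k \<omega>) = of_nat n" for n
      by (simp add: s_def not_le)
    then show ?thesis by (simp add: ennreal_SUP_of_nat_eq_top)
  qed
  then have "(\<integral>\<^sup>+ \<omega>. hit_time a \<omega> \<partial>P x) \<le> (\<integral>\<^sup>+ \<omega>. (SUP n. \<Sum>k<n. s k \<omega>) \<partial>P x)"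
    by (rule nn_integral_mono)
  also have "\<dots> = (SUP n. \<integral>\<^sup>+ \<omega>. (\<Sum>k<n. s k \<omega>) \<partial>P x)"
    by (rule nn_integral_monotone_convergence_SUP)
       (auto simp: incseq_def le_fun_def intro!: sum_mono2)
  also have "\<dots> \<le> f x"
    using bound[OF x] by (rule SUP_least)
  finally show ?thesis .
qed

end

section \<open>The critical constant\<close>

lemma Gamma_nn_integral_exp:
  assumes "z > (0::real)"
  shows "(\<integral>\<^sup>+ t. ennreal (t powr (z - 1) * exp (- t)) * indicator {0<..} t \<partial>lborel) = ennreal (Gamma z)"
  unfolding Gamma_conv_nn_integral_real[OF assms]
  by (rule nn_integral_cong) (auto simp: indicator_def exp_minus field_simps)

lemma Gamma_reflection_real: "Gamma x * Gamma (1 - x :: real) = pi / sin (pi * x)"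
proof -
  have "complex_of_real (Gamma x * Gamma (1 - x)) = of_real (pi / sin (pi * x))"
    using Gamma_reflection_complex[of "of_real x"]
    unfolding of_real_mult of_real_divide Gamma_complex_of_real[symmetric] sin_of_real[symmetric] of_real_diff of_real_1 .
  then show ?thesis by (simp only: of_real_eq_iff)
qed

text \<open>On (1, 2) the sine of \<pi> * \<alpha> is negative. Shifting the angle by \<pi> makes it
  positive and removes the absolute value; the reflection formula then applies at \<alpha> -
  1.\<close>

lemma abs_csc_eq_Gamma:
  assumes "1 < \<alpha>" "\<alpha> < 2"
  shows "pi * \<bar>1 / sin (pi * \<alpha>)\<bar> = Gamma (2 - \<alpha>) * Gamma (\<alpha> - 1)"
proof -
  have "0 < sin (pi * (\<alpha> - 1))"
    using assms by (intro sin_gt_zero) (auto simp: field_simps)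
  moreover have "sin (pi * (\<alpha> - 1)) = - sin (pi * \<alpha>)"
    by (simp add: right_diff_distrib sin_diff)
  ultimately have "pi * \<bar>1 / sin (pi * \<alpha>)\<bar> = pi / sin (pi * (\<alpha> - 1))"
    by simp
  also have "\<dots> = Gamma (\<alpha> - 1) * Gamma (1 - (\<alpha> - 1))"
    by (rule Gamma_reflection_real[symmetric])
  also have "1 - (\<alpha> - 1) = 2 - \<alpha>" by simp
  finally show ?thesis by simp
qed

lemma nn_integral_exp_minus:
  assumes w: "0 < (w::real)"
  shows "(\<integral>\<^sup>+ s. ennreal (exp (- (s * w))) * indicator {0..} s \<partial>lborel) = ennreal (1 / w)"
proof -
  have "(\<integral>\<^sup>+ s. ennreal (exp (- (s * w))) * indicator {0..} s \<partial>lborel) = ennreal (0 - (- exp (- (0 * w)) / w))"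
  proof (rule nn_integral_FTC_atLeast)
    show "DERIV (\<lambda>s. - exp (- (s * w)) / w) s :> exp (- (s * w))" for s
      using w by (auto intro!: derivative_eq_intros)
    show "((\<lambda>s. - exp (- (s * w)) / w) \<longlongrightarrow> 0) at_top"
      using w by real_asymp
  qed auto
  then show ?thesis by simp
qed

text \<open>A Beta integral: 1 / (1 + u) is the Laplace integral of exp (- s * (1 + u)) over s > 0,
  and Tonelli swaps the order. The \<open>u\<close>-integral is a rescaled Gamma integral at 2 -
  \<alpha>, and what remains in \<open>s\<close> is the one at \<alpha> - 1.\<close>

lemma nn_integral_powr_div_one_plus:
  assumes \<alpha>: "1 < \<alpha>" "\<alpha> < 2"
  shows "(\<integral>\<^sup>+ u. ennreal (u powr (1 - \<alpha>) / (1 + u)) * indicator {0<..} u \<partial>lborel)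
    = ennreal (pi * \<bar>1 / sin (pi * \<alpha>)\<bar>)"
proof -
  let ?h = "\<lambda>u s. ennreal (u powr (1 - \<alpha>) * exp (- (s * (1 + u)))) * indicator {0<..} u * indicator {0<..} s"
  have inner_s: "(\<integral>\<^sup>+ s. ?h u s \<partial>lborel) = ennreal (u powr (1 - \<alpha>) / (1 + u)) * indicator {0<..} u" for u :: real
  proof (cases "u > 0")
    case True
    have *: "(\<integral>\<^sup>+ s. ennreal (exp (- (s * (1 + u)))) * indicator {0..} s \<partial>lborel) = ennreal (1 / (1 + u))"
      using True by (intro nn_integral_exp_minus) auto
    have "(\<integral>\<^sup>+ s. ?h u s \<partial>lborel)
      = (\<integral>\<^sup>+ s. ennreal (u powr (1 - \<alpha>)) * (ennreal (exp (- (s * (1 + u)))) * indicator {0..} s) \<partial>lborel)"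
      by (rule nn_integral_cong_AE, rule AE_mp[OF AE_lborel_singleton[of 0]])
         (use True in \<open>auto simp: indicator_def ennreal_mult'\<close>)
    also have "\<dots> = ennreal (u powr (1 - \<alpha>)) * ennreal (1 / (1 + u))"
      by (subst nn_integral_cmult) (simp_all add: *)
    also have "\<dots> = ennreal (u powr (1 - \<alpha>) / (1 + u))"
      using True by (subst ennreal_mult''[symmetric]) auto
    finally show ?thesis using True by simp
  qed simp
  have inner_u: "(\<integral>\<^sup>+ u. ?h u s \<partial>lborel) = ennreal (Gamma (2 - \<alpha>)) * (ennreal (s powr ((\<alpha> - 1) - 1) * exp (- s)) * indicator {0<..} s)" for s :: real
  proof (cases "s > 0")
    case True
    have e: "ennreal ((s * u) powr (2 - \<alpha> - 1) * exp (- (s * u))) * indicator {0<..} (s * u)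
       = ennreal (s powr (1 - \<alpha>)) * (ennreal (u powr (1 - \<alpha>) * exp (- (s * u))) * indicator {0<..} u)" for u
      using True by (auto simp: indicator_def powr_mult zero_less_mult_iff ennreal_mult'[symmetric] mult_ac)
    have "ennreal (Gamma (2 - \<alpha>)) = (\<integral>\<^sup>+ t. ennreal (t powr (2 - \<alpha> - 1) * exp (- t)) * indicator {0<..} t \<partial>lborel)"
      using Gamma_nn_integral_exp[of "2 - \<alpha>"] \<alpha> by simp
    also have "\<dots> = ennreal s * (\<integral>\<^sup>+ u. ennreal ((s * u) powr (2 - \<alpha> - 1) * exp (- (s * u))) * indicator {0<..} (s * u) \<partial>lborel)"
      by (subst nn_integral_real_affine[where c = s and t = 0]) (use True in simp_all)
    also have "\<dots> = ennreal s * (ennreal (s powr (1 - \<alpha>)) * (\<integral>\<^sup>+ u. ennreal (u powr (1 - \<alpha>) * exp (- (s * u))) * indicator {0<..} u \<partial>lborel))"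
      unfolding e by (subst nn_integral_cmult) simp_all
    finally have G: "ennreal (Gamma (2 - \<alpha>)) = ennreal (s * s powr (1 - \<alpha>)) * (\<integral>\<^sup>+ u. ennreal (u powr (1 - \<alpha>) * exp (- (s * u))) * indicator {0<..} u \<partial>lborel)"
      using True by (simp add: ennreal_mult' mult.assoc)
    \<comment> \<open>The factor \<open>s * s powr (1 - \<alpha>)\<close> is cancelled by
      multiplying with its reciprocal power, which avoids division in
      \<open>ennreal\<close>.\<close>
    have pw: "s powr (\<alpha> - 2) * (s * s powr (1 - \<alpha>)) = 1"
      using True by (simp add: powr_add[symmetric] powr_mult_base)
    have "ennreal (s powr (\<alpha> - 2)) * ennreal (Gamma (2 - \<alpha>))
       = (ennreal (s powr (\<alpha> - 2)) * ennreal (s * s powr (1 - \<alpha>))) * (\<integral>\<^sup>+ u. ennreal (u powr (1 - \<alpha>) * exp (- (s * u))) * indicator {0<..} u \<partial>lborel)"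
      unfolding G by (simp add: mult.assoc)
    also have "ennreal (s powr (\<alpha> - 2)) * ennreal (s * s powr (1 - \<alpha>)) = 1"
      using pw by (simp flip: ennreal_mult')
    finally have I: "(\<integral>\<^sup>+ u. ennreal (u powr (1 - \<alpha>) * exp (- (s * u))) * indicator {0<..} u \<partial>lborel) = ennreal (s powr (\<alpha> - 2)) * ennreal (Gamma (2 - \<alpha>))"
      by simp
    have "(\<integral>\<^sup>+ u. ?h u s \<partial>lborel) = (\<integral>\<^sup>+ u. ennreal (exp (- s)) * (ennreal (u powr (1 - \<alpha>) * exp (- (s * u))) * indicator {0<..} u) \<partial>lborel)"
      using True by (intro nn_integral_cong) (auto simp: indicator_def ennreal_mult'[symmetric] exp_add[symmetric] algebra_simps)
    also have "\<dots> = ennreal (exp (- s)) * (ennreal (s powr (\<alpha> - 2)) * ennreal (Gamma (2 - \<alpha>)))"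
      by (subst nn_integral_cmult) (simp_all add: I)
    finally show ?thesis using True by (simp add: ennreal_mult' mult_ac)
  qed simp
  have "(\<integral>\<^sup>+ u. ennreal (u powr (1 - \<alpha>) / (1 + u)) * indicator {0<..} u \<partial>lborel) = (\<integral>\<^sup>+ u. (\<integral>\<^sup>+ s. ?h u s \<partial>lborel) \<partial>lborel)"
    unfolding inner_s ..
  also have "\<dots> = (\<integral>\<^sup>+ s. (\<integral>\<^sup>+ u. ?h u s \<partial>lborel) \<partial>lborel)"
    by (rule lborel_pair.Fubini'[symmetric]) measurable
  also have "\<dots> = ennreal (Gamma (2 - \<alpha>)) * ennreal (Gamma (\<alpha> - 1))"
    unfolding inner_u by (subst nn_integral_cmult) (use \<alpha> in \<open>simp_all only: Gamma_nn_integral_exp diff_gt_0_iff_gt, measurable\<close>)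
  also have "\<dots> = ennreal (Gamma (2 - \<alpha>) * Gamma (\<alpha> - 1))"
    using \<alpha> by (intro ennreal_mult[symmetric]) (auto intro!: less_imp_le Gamma_real_pos)
  finally show ?thesis using abs_csc_eq_Gamma[OF \<alpha>] by simp
qed

section \<open>Heavy-tailed increments\<close>

definition phi :: "real \<Rightarrow> real" where "phi u = u - ln (1 + u)"

lemma phi_measurable [measurable]: "phi \<in> borel_measurable borel"
  unfolding phi_def[abs_def] by measurable

lemma phi_nonneg: "0 \<le> u \<Longrightarrow> 0 \<le> phi u"
  unfolding phi_def using ln_add_one_self_le_self[of u] by simp

lemma phi_le: "0 \<le> u \<Longrightarrow> phi u \<le> u"
  unfolding phi_def by simp

text \<open>The tangent to the logarithm at 2 has slope 1 / 2, so \<open>phi\<close> grows at least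
  linearly. A finite expectation of \<open>phi\<close> thus gives integrability of the positive part
  of the increment.\<close>

lemma le_phi: "0 \<le> u \<Longrightarrow> u \<le> 2 * phi u + 2"
proof -
  assume u: "0 \<le> u"
  have "ln ((1 + u) / 2) \<le> (1 + u) / 2 - 1"
    using u by (intro ln_le_minus_one) auto
  moreover have "ln ((1 + u) / 2) = ln (1 + u) - ln 2"
    using u by (simp add: ln_div)
  moreover have "ln 2 < (1::real)" using ln_2_less_1 .
  ultimately show ?thesis unfolding phi_def by argo
qed

text \<open>With v = ln (1 + u) this is 1 + v + v^2 / 2 \<le> exp v. It lets \<open>phi\<close>
  absorb the quadratic term in the expansion of \<open>1 / (1 + ln z)\<close>.\<close>

lemma ln_squared_le_phi: "0 \<le> u \<Longrightarrow> (ln (1 + u))\<^sup>2 \<le> 2 * phi u"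
proof -
  assume u: "0 \<le> u"
  have "1 + ln (1 + u) + (ln (1 + u))\<^sup>2 / 2 \<le> exp (ln (1 + u))"
    using u by (intro exp_lower_Taylor_quadratic) auto
  then show ?thesis using u by (simp add: phi_def)
qed

text \<open>The weight is 1 / z - 1 / (z + y), the derivative of \<open>phi (y / z)\<close> in
  \<open>y\<close>. For t < 0 the interval is empty and the \<open>max\<close> gives
  \<open>phi 0 = 0\<close>.\<close>

lemma nn_integral_phi_derivative:
  assumes z: "z > 0"
  shows "(\<integral>\<^sup>+ y. ennreal (y / (z * (z + y))) * indicator {0<..<t} y \<partial>lborel) = ennreal (phi (max 0 t / z))"
proof (cases "t \<ge> 0")
  case True
  have "(\<integral>\<^sup>+ y. ennreal (y / (z * (z + y))) * indicator {0..t} y \<partial>lborel) = ennreal (phi (t / z) - phi (0 / z))"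
  proof (rule nn_integral_FTC_Icc)
    fix y assume "y \<in> {0..t}"
    then have y: "0 \<le> y" by simp
    then have "0 < 1 + y / z" using z by (simp add: add_pos_nonneg)
    then have "((\<lambda>y. phi (y / z)) has_real_derivative (1 / z - (1 / z) / (1 + y / z))) (at y)"
      unfolding phi_def using z by (auto intro!: derivative_eq_intros)
    moreover have "1 / z - (1 / z) / (1 + y / z) = y / (z * (z + y))"
      using y z by (simp add: field_simps)
    ultimately show "((\<lambda>y. phi (y / z)) has_real_derivative y / (z * (z + y))) (at y)"
      by simp
    show "0 \<le> y / (z * (z + y))" using y z by simp
  qed (use True in \<open>auto\<close>)
  moreover have "(\<integral>\<^sup>+ y. ennreal (y / (z * (z + y))) * indicator {0<..<t} y \<partial>lborel)
    = (\<integral>\<^sup>+ y. ennreal (y / (z * (z + y))) * indicator {0..t} y \<partial>lborel)"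
    by (rule nn_integral_cong_AE, rule AE_mp[OF AE_lborel_singleton[of 0]], rule AE_mp[OF AE_lborel_singleton[of t]])
       (auto simp: indicator_def)
  ultimately show ?thesis using True by (simp add: phi_def max_def)
qed (auto simp: phi_def max_def)

text \<open>Tonelli on the region 0 < y < t: integrating over \<open>t\<close> first leaves the tail
  of \<open>N\<close>.\<close>

lemma nn_integral_layer_cake:
  fixes g :: "real \<Rightarrow> ennreal"
  assumes "prob_space N" and [measurable_cong]: "sets N = sets borel" and [measurable]: "g \<in> borel_measurable borel"
  shows "(\<integral>\<^sup>+ t. (\<integral>\<^sup>+ y. g y * indicator {0<..<t} y \<partial>lborel) \<partial>N)
    = (\<integral>\<^sup>+ y. g y * indicator {0<..} y * emeasure N {y<..} \<partial>lborel)"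
proof -
  interpret prob_space N by fact
  interpret pair_sigma_finite lborel N by standard
  have eq: "g y * indicator {0<..<t} y = g y * indicator {0<..} y * indicator {y<..} t" for y t :: real
    by (auto simp: indicator_def)
  have [measurable]: "Measurable.pred (lborel \<Otimes>\<^sub>M N) (\<lambda>p. snd p \<in> {fst p<..})"
    by simp measurable
  have "(\<integral>\<^sup>+ t. (\<integral>\<^sup>+ y. g y * indicator {0<..<t} y \<partial>lborel) \<partial>N) = (\<integral>\<^sup>+ y. (\<integral>\<^sup>+ t. g y * indicator {0<..} y * indicator {y<..} t \<partial>N) \<partial>lborel)"
    unfolding eq by (rule Fubini') measurable
  also have "\<dots> = (\<integral>\<^sup>+ y. g y * indicator {0<..} y * emeasure N {y<..} \<partial>lborel)"
    by (intro nn_integral_cong, subst nn_integral_cmult_indicator) (simp_all add: assms)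
  finally show ?thesis .
qed

lemma nn_integral_phi_tail:
  assumes "prob_space N" "sets N = sets borel" "z > 0"
  shows "(\<integral>\<^sup>+ t. ennreal (phi (max 0 t / z)) \<partial>N)
    = (\<integral>\<^sup>+ y. ennreal (y / (z * (z + y))) * indicator {0<..} y * emeasure N {y<..} \<partial>lborel)"
  using nn_integral_layer_cake[OF assms(1,2), of "\<lambda>y. ennreal (y / (z * (z + y)))"] assms(3)
  by (simp add: nn_integral_phi_derivative)

text \<open>Substitution y = z * u. The set \<open>S\<close> is [Y, \<infinity>) in the lower
  estimate and (0, \<infinity>) in the upper one.\<close>

lemma nn_integral_phi_scaling:
  assumes z: "z > 0" and [measurable]: "S \<in> sets borel" and S: "S \<subseteq> {0<..}"
  shows "(\<integral>\<^sup>+ y. ennreal (y / (z * (z + y)) * y powr - \<alpha>) * indicator S y \<partial>lborel)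
    = ennreal (z powr - \<alpha>) * (\<integral>\<^sup>+ u. ennreal (u powr (1 - \<alpha>) / (1 + u)) * indicator S (z * u) \<partial>lborel)"
proof -
  have e: "ennreal z * (ennreal ((z * u) / (z * (z + z * u)) * (z * u) powr - \<alpha>) * indicator S (z * u))
    = ennreal (z powr - \<alpha>) * (ennreal (u powr (1 - \<alpha>) / (1 + u)) * indicator S (z * u))" for u
  proof (cases "z * u \<in> S")
    case True
    then have u: "u > 0" using S z by (auto simp: zero_less_mult_iff)
    have "z * ((z * u) / (z * (z + z * u)) * (z * u) powr - \<alpha>) = z powr - \<alpha> * (u * u powr - \<alpha> / (1 + u))"
    proof -
      have "z * ((z * u) / (z * (z + z * u))) = (z * z * u) / (z * z * (1 + u))"
        by (simp add: algebra_simps)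
      also have "\<dots> = u / (1 + u)" using z by simp
      finally have "z * ((z * u) / (z * (z + z * u))) = u / (1 + u)" .
      moreover have "(z * u) powr - \<alpha> = z powr - \<alpha> * u powr - \<alpha>"
        using z u by (simp add: powr_mult)
      ultimately show ?thesis by (metis (no_types, lifting) mult.assoc mult.left_commute times_divide_eq_left)
    qed
    also have "u * u powr - \<alpha> = u powr (1 - \<alpha>)"
      using u by (simp add: powr_mult_base)
    finally show ?thesis using True z u by (simp add: ennreal_mult'[symmetric])
  qed simp
  have "(\<integral>\<^sup>+ y. ennreal (y / (z * (z + y)) * y powr - \<alpha>) * indicator S y \<partial>lborel)
     = ennreal z * (\<integral>\<^sup>+ u. ennreal ((z * u) / (z * (z + z * u)) * (z * u) powr - \<alpha>) * indicator S (z * u) \<partial>lborel)"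
    by (subst nn_integral_real_affine[where c = z and t = 0]) (use z in simp_all)
  also have "\<dots> = (\<integral>\<^sup>+ u. ennreal z * (ennreal ((z * u) / (z * (z + z * u)) * (z * u) powr - \<alpha>) * indicator S (z * u)) \<partial>lborel)"
    by (rule nn_integral_cmult[symmetric]) measurable
  also have "\<dots> = ennreal (z powr - \<alpha>) * (\<integral>\<^sup>+ u. ennreal (u powr (1 - \<alpha>) / (1 + u)) * indicator S (z * u) \<partial>lborel)"
    unfolding e by (rule nn_integral_cmult) measurable
  finally show ?thesis .
qed

text \<open>The tail bound says nothing below \<open>Y\<close>. Since k / c lies strictly below the
  full integral, a truncation to u \<ge> 1 / (n + 1) still exceeds it, and for z \<ge> Y * (n + 1)
  this range satisfies z * u \<ge> Y.\<close>

lemma phi_expectation_lower: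
  assumes \<alpha>: "1 < \<alpha>" "\<alpha> < 2" and c: "0 < c" and Y: "0 < Y"
    and k: "0 \<le> k" "k < c * (pi * \<bar>1 / sin (pi * \<alpha>)\<bar>)"
  shows "\<exists>Z>0. \<forall>z\<ge>Z. \<forall>N. prob_space N \<longrightarrow> sets N = sets borel \<longrightarrow>
    (\<forall>y\<ge>Y. c * y powr - \<alpha> \<le> measure N {y<..}) \<longrightarrow>
    ennreal (k * z powr - \<alpha>) \<le> (\<integral>\<^sup>+ t. ennreal (phi (max 0 t / z)) \<partial>N)"
proof -
  let ?q = "\<lambda>u. ennreal (u powr (1 - \<alpha>) / (1 + u))"
  have UN: "(SUP n. indicator {1 / (real n + 1)..} u :: ennreal) = indicator {0<..} u" for u :: real
  proof (cases "u > 0")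
    case True
    then obtain n where "inverse (of_nat (Suc n)) < u" using reals_Archimedean by blast
    then have n: "1 / (real n + 1) \<le> u" by (simp add: inverse_eq_divide add.commute)
    show ?thesis
    proof (rule antisym)
      have "(indicator {0<..} u :: ennreal) = indicator {1 / (real n + 1)..} u" using n True by simp
      also have "\<dots> \<le> (SUP n. indicator {1 / (real n + 1)..} u)" by (rule SUP_upper) simp
      finally show "(indicator {0<..} u :: ennreal) \<le> (SUP n. indicator {1 / (real n + 1)..} u)" .
      show "(SUP n. indicator {1 / (real n + 1)..} u) \<le> (indicator {0<..} u :: ennreal)"
        using True by (intro SUP_least) (simp split: split_indicator)
    qed
  next
    case False
    then have "\<not> 1 / (real n + 1) \<le> u" for n :: nat
      by (smt (verit) divide_pos_pos of_nat_0_le_iff)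
    then show ?thesis using False by simp
  qed
  have "(SUP n. \<integral>\<^sup>+ u. ?q u * indicator {1 / (real n + 1)..} u \<partial>lborel)
     = (\<integral>\<^sup>+ u. (SUP n. ?q u * indicator {1 / (real n + 1)..} u) \<partial>lborel)"
  proof (rule nn_integral_monotone_convergence_SUP[symmetric])
    have "(indicator {1 / (real m + 1)..} u :: ennreal) \<le> indicator {1 / (real n + 1)..} u" if "m \<le> n" for m n and u :: real
    proof -
      have "1 / (real n + 1) \<le> 1 / (real m + 1)" using that by (intro frac_le) auto
      then show ?thesis by (auto simp: indicator_def)
    qed
    then show "incseq (\<lambda>n u. ?q u * indicator {1 / (real n + 1)..} u)"
      by (auto simp: incseq_def le_fun_def intro!: mult_left_mono)
  qed measurable
  also have "\<dots> = (\<integral>\<^sup>+ u. ?q u * indicator {0<..} u \<partial>lborel)"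
    by (simp add: UN SUP_mult_left_ennreal[symmetric])
  also have "\<dots> = ennreal (pi * \<bar>1 / sin (pi * \<alpha>)\<bar>)"
    by (rule nn_integral_powr_div_one_plus[OF \<alpha>])
  also have "ennreal (k / c) < \<dots>"
  proof (rule ennreal_lessI)
    show "0 < pi * \<bar>1 / sin (pi * \<alpha>)\<bar>"
      using k c le_less_trans[OF k] by (simp only: zero_less_mult_iff) auto
    show "k / c < pi * \<bar>1 / sin (pi * \<alpha>)\<bar>"
      using k(2) c by (simp add: divide_less_eq mult.commute)
  qed
  finally obtain n :: nat where n: "ennreal (k / c) < (\<integral>\<^sup>+ u. ?q u * indicator {1 / (real n + 1)..} u \<partial>lborel)"
    unfolding less_SUP_iff by auto
  show ?thesis
  proof (intro exI[of _ "Y * (real n + 1)"] conjI allI impI)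
    show "0 < Y * (real n + 1)" using Y by simp
    fix z N
    assume z: "Y * (real n + 1) \<le> z" and N: "prob_space N" "sets N = sets borel"
      and tail: "\<forall>y\<ge>Y. c * y powr - \<alpha> \<le> measure N {y<..}"
    interpret prob_space N by fact
    have z0: "z > 0" using z Y by (smt (verit) mult_pos_pos of_nat_0_le_iff)
    have "ennreal (k * z powr - \<alpha>) = ennreal c * (ennreal (z powr - \<alpha>) * ennreal (k / c))"
      using c k by (simp flip: ennreal_mult')
    also have "\<dots> \<le> ennreal c * (ennreal (z powr - \<alpha>) * (\<integral>\<^sup>+ u. ?q u * indicator {Y..} (z * u) \<partial>lborel))"
    proof (intro mult_left_mono)
      have "1 / (real n + 1) \<le> u \<Longrightarrow> Y \<le> z * u" for u
      proof -
        assume u: "1 / (real n + 1) \<le> u"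
        have "Y = Y * (real n + 1) * (1 / (real n + 1))" by simp
        also have "\<dots> \<le> z * u" using z u z0 by (intro mult_mono) auto
        finally show ?thesis .
      qed
      then have "(\<integral>\<^sup>+ u. ?q u * indicator {1 / (real n + 1)..} u \<partial>lborel) \<le> (\<integral>\<^sup>+ u. ?q u * indicator {Y..} (z * u) \<partial>lborel)"
        by (intro nn_integral_mono) (auto simp: indicator_def)
      then show "ennreal (k / c) \<le> (\<integral>\<^sup>+ u. ?q u * indicator {Y..} (z * u) \<partial>lborel)"
        using n by simp
    qed auto
    also have "\<dots> = ennreal c * (\<integral>\<^sup>+ y. ennreal (y / (z * (z + y)) * y powr - \<alpha>) * indicator {Y..} y \<partial>lborel)"
      using Y z0 by (subst nn_integral_phi_scaling) auto
    also have "\<dots> = (\<integral>\<^sup>+ y. ennreal c * (ennreal (y / (z * (z + y)) * y powr - \<alpha>) * indicator {Y..} y) \<partial>lborel)"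
      by (rule nn_integral_cmult[symmetric]) measurable
    also have "\<dots> \<le> (\<integral>\<^sup>+ y. ennreal (y / (z * (z + y))) * indicator {0<..} y * emeasure N {y<..} \<partial>lborel)"
    proof (rule nn_integral_mono)
      fix y :: real
      show "ennreal c * (ennreal (y / (z * (z + y)) * y powr - \<alpha>) * indicator {Y..} y)
         \<le> ennreal (y / (z * (z + y))) * indicator {0<..} y * emeasure N {y<..}"
      proof (cases "y \<ge> Y")
        case True
        then have "ennreal c * ennreal (y / (z * (z + y)) * y powr - \<alpha>) = ennreal (y / (z * (z + y))) * ennreal (c * y powr - \<alpha>)"
          using c z0 Y by (simp flip: ennreal_mult' add: mult_ac)
        also have "\<dots> \<le> ennreal (y / (z * (z + y))) * emeasure N {y<..}"
          using tail True by (intro mult_left_mono) (auto simp: emeasure_eq_measure)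
        finally show ?thesis using True Y by simp
      qed simp
    qed
    also have "\<dots> = (\<integral>\<^sup>+ t. ennreal (phi (max 0 t / z)) \<partial>N)"
      by (rule nn_integral_phi_tail[OF N z0, symmetric])
    finally show "ennreal (k * z powr - \<alpha>) \<le> (\<integral>\<^sup>+ t. ennreal (phi (max 0 t / z)) \<partial>N)" .
  qed
qed

text \<open>Up to \<open>Y\<close> the tail is at most 1 and the weight at most Y / z^2; beyond
  \<open>Y\<close> the tail bound applies, and its integral is extended to (0, \<infinity>).\<close>

lemma phi_expectation_upper:
  assumes \<alpha>: "1 < \<alpha>" "\<alpha> < 2" and c: "0 \<le> c" and Y: "0 < Y"
    and k: "c * (pi * \<bar>1 / sin (pi * \<alpha>)\<bar>) < k"
  shows "\<exists>Z>0. \<forall>z\<ge>Z. \<forall>N. prob_space N \<longrightarrow> sets N = sets borel \<longrightarrow>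
    (\<forall>y\<ge>Y. measure N {y<..} \<le> c * y powr - \<alpha>) \<longrightarrow>
    (\<integral>\<^sup>+ t. ennreal (phi (max 0 t / z)) \<partial>N) \<le> ennreal (k * z powr - \<alpha>)"
proof -
  let ?q = "\<lambda>u. ennreal (u powr (1 - \<alpha>) / (1 + u))"
  define I where "I = pi * \<bar>1 / sin (pi * \<alpha>)\<bar>"
  have "0 \<le> I" by (simp add: I_def)
  \<comment> \<open>The range up to \<open>Y\<close> costs Y^2 / z^2. In units of z powr - \<alpha>
    this vanishes because \<alpha> < 2, so it fits into the gap between c * I and k.\<close>
  have "((\<lambda>z. Y\<^sup>2 * z powr (\<alpha> - 2)) \<longlongrightarrow> 0) at_top"
    using \<alpha> by real_asymp
  then have "eventually (\<lambda>z. Y\<^sup>2 * z powr (\<alpha> - 2) < k - c * I) at_top"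
    using k by (intro order_tendstoD) (auto simp: I_def)
  then obtain Z where Z: "\<And>z. z \<ge> Z \<Longrightarrow> Y\<^sup>2 * z powr (\<alpha> - 2) < k - c * I"
    by (auto simp: eventually_at_top_linorder)
  show ?thesis
  proof (intro exI[of _ "max 1 Z"] conjI allI impI)
    fix z N
    assume z: "max 1 Z \<le> z" and N: "prob_space N" "sets N = sets borel"
      and tail: "\<forall>y\<ge>Y. measure N {y<..} \<le> c * y powr - \<alpha>"
    interpret prob_space N by fact
    have z0: "z > 0" using z by simp
    have "(\<integral>\<^sup>+ t. ennreal (phi (max 0 t / z)) \<partial>N)
      = (\<integral>\<^sup>+ y. ennreal (y / (z * (z + y))) * indicator {0<..} y * emeasure N {y<..} \<partial>lborel)"
      by (rule nn_integral_phi_tail[OF N z0])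
    also have "\<dots> \<le> (\<integral>\<^sup>+ y. ennreal (Y / z\<^sup>2) * indicator {0..Y} y
        + ennreal c * (ennreal (y / (z * (z + y)) * y powr - \<alpha>) * indicator {0<..} y) \<partial>lborel)"
    proof (rule nn_integral_mono)
      fix y :: real
      consider "y \<le> 0" | "0 < y" "y \<le> Y" | "Y < y" by linarith
      then show "ennreal (y / (z * (z + y))) * indicator {0<..} y * emeasure N {y<..}
        \<le> ennreal (Y / z\<^sup>2) * indicator {0..Y} y
          + ennreal c * (ennreal (y / (z * (z + y)) * y powr - \<alpha>) * indicator {0<..} y)"
      proof cases
        case 2
        have "ennreal (y / (z * (z + y))) * emeasure N {y<..} \<le> ennreal (y / (z * (z + y))) * 1"
          by (intro mult_left_mono emeasure_le_1) auto
        also have "\<dots> \<le> ennreal (Y / z\<^sup>2)"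
          unfolding power2_eq_square mult_1_right using 2 z0 by (intro ennreal_leI frac_le) auto
        finally show ?thesis using 2 by (simp add: add_increasing2)
      next
        case 3
        have "ennreal (y / (z * (z + y))) * emeasure N {y<..} \<le> ennreal (y / (z * (z + y))) * ennreal (c * y powr - \<alpha>)"
          using tail 3 by (intro mult_left_mono) (auto simp: emeasure_eq_measure intro!: ennreal_leI)
        also have "\<dots> = ennreal c * ennreal (y / (z * (z + y)) * y powr - \<alpha>)"
          using c z0 Y 3 by (simp flip: ennreal_mult' add: mult_ac)
        finally show ?thesis using 3 Y by simp
      qed simp
    qed
    also have "\<dots> = ennreal (Y / z\<^sup>2) * ennreal Y + ennreal c * (ennreal (z powr - \<alpha>) * (\<integral>\<^sup>+ u. ?q u * indicator {0<..} (z * u) \<partial>lborel))"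
      (is "_ = _ + _ * ?s")
    proof -
      have "(\<integral>\<^sup>+ y. ennreal (Y / z\<^sup>2) * indicator {0..Y} y \<partial>lborel) = ennreal (Y / z\<^sup>2) * ennreal Y"
        using Y by (subst nn_integral_cmult_indicator) auto
      moreover have "(\<integral>\<^sup>+ y. ennreal (y / (z * (z + y)) * y powr - \<alpha>) * indicator {0<..} y \<partial>lborel) = ?s"
        using z0 by (rule nn_integral_phi_scaling) auto
      ultimately show ?thesis
        by (subst nn_integral_add) (measurable, subst nn_integral_cmult, measurable)
    qed
    also have "(\<integral>\<^sup>+ u. ?q u * indicator {0<..} (z * u) \<partial>lborel) = ennreal I"
      unfolding I_def nn_integral_powr_div_one_plus[OF \<alpha>, symmetric]
      by (intro nn_integral_cong) (use z0 in \<open>auto simp: indicator_def zero_less_mult_iff\<close>)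
    also have "ennreal (Y / z\<^sup>2) * ennreal Y + ennreal c * (ennreal (z powr - \<alpha>) * ennreal I)
        = ennreal (Y\<^sup>2 / z\<^sup>2 + c * z powr - \<alpha> * I)"
      using Y c \<open>0 \<le> I\<close> by (simp flip: ennreal_mult' ennreal_plus add: power2_eq_square mult_ac)
    also have "\<dots> \<le> ennreal (k * z powr - \<alpha>)"
    proof (rule ennreal_leI)
      have "Y\<^sup>2 / z\<^sup>2 = Y\<^sup>2 * z powr (\<alpha> - 2) * z powr - \<alpha>"
        using z0 powr_add[of z "\<alpha> - 2" "- \<alpha>"] by (simp add: powr_minus divide_inverse)
      also have "\<dots> \<le> (k - c * I) * z powr - \<alpha>"
        using Z[of z] z by (intro mult_right_mono) auto
      finally show "Y\<^sup>2 / z\<^sup>2 + c * z powr - \<alpha> * I \<le> k * z powr - \<alpha>"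
        by (simp add: algebra_simps)
    qed
    finally show "(\<integral>\<^sup>+ t. ennreal (phi (max 0 t / z)) \<partial>N) \<le> ennreal (k * z powr - \<alpha>)" .
  qed simp
qed


section \<open>Integrability and one-step drift of the logarithmic functions\<close>

lemma le_one_plus_powr:
  fixes a :: real
  assumes "0 \<le> a" "p \<le> q" "0 < p"
  shows "a powr p \<le> 1 + a powr q"
proof (cases "a \<le> 1")
  case True
  then have "a powr p \<le> 1" using assms by (intro powr_le1) auto
  then show ?thesis by (simp add: add_increasing2)
next
  case False
  then show ?thesis using assms by (simp add: powr_mono add_increasing)
qed

text \<open>A Bochner integral such as \<open>drift\<close> is 0 by convention when the increment is
  not integrable, so integrability must be secured before the drift can be used as a mean.
  \<open>le_phi\<close> controls the positive part, the moment of order \<open>b\<close> the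
  negative one.\<close>

lemma integrable_increment:
  assumes "prob_space N" and [measurable_cong]: "sets N = sets borel" and z: "0 < z" and "1 \<le> b"
    and phi: "(\<integral>\<^sup>+ t. ennreal (phi (max 0 t / z)) \<partial>N) < \<infinity>"
    and neg: "(\<integral>\<^sup>+ t. ennreal (neg_part t powr b) \<partial>N) < \<infinity>"
  shows "integrable N (\<lambda>t. t)"
proof -
  interpret prob_space N by fact
  have phi': "integrable N (\<lambda>t. phi (max 0 t / z))"
    using phi z by (intro integrableI_nonneg) (auto intro!: phi_nonneg)
  have neg': "integrable N (\<lambda>t. neg_part t powr b)"
    using neg by (intro integrableI_nonneg) auto
  show ?thesis
  proof (rule Bochner_Integration.integrable_bound)
    show "integrable N (\<lambda>t. z * (2 * phi (max 0 t / z) + 2) + (1 + neg_part t powr b))"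
      using phi' neg' by auto
    show "AE t in N. norm t \<le> norm (z * (2 * phi (max 0 t / z) + 2) + (1 + neg_part t powr b))"
    proof (rule AE_I2)
      fix t
      have "max 0 t / z \<le> 2 * phi (max 0 t / z) + 2" using z by (intro le_phi) auto
      then have "max 0 t \<le> z * (2 * phi (max 0 t / z) + 2)"
        using z by (simp add: pos_divide_le_eq mult.commute)
      moreover have "neg_part t powr 1 \<le> 1 + neg_part t powr b"
        using \<open>1 \<le> b\<close> by (intro le_one_plus_powr) (auto simp: neg_part_def)
      then have "neg_part t \<le> 1 + neg_part t powr b" by (simp add: neg_part_def)
      moreover have "\<bar>t\<bar> = max 0 t + neg_part t" by (simp add: neg_part_def)
      ultimately show "norm t \<le> norm (z * (2 * phi (max 0 t / z) + 2) + (1 + neg_part t powr b))"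
        unfolding real_norm_def by linarith
    qed
  qed measurable
qed

text \<open>For t \<ge> 0 the increment of the logarithm is exactly t / z - phi (t / z); for t < 0
  concavity bounds it by t / z. The mean is thus compared with \<open>J\<close> alone. The range
  condition makes \<open>ln (z + t)\<close> nonnegative, so \<open>ennreal\<close> does not clip
  it.\<close>

lemma ln_supermartingale_step:
  assumes "prob_space N" and [measurable_cong]: "sets N = sets borel" and z: "1 \<le> z"
    and range: "AE t in N. 1 \<le> z + t" and int: "integrable N (\<lambda>t. t)"
    and J: "ennreal J \<le> (\<integral>\<^sup>+ t. ennreal (phi (max 0 t / z)) \<partial>N)"
    and drift: "(\<integral>t. t \<partial>N) / z \<le> J"
  shows "(\<integral>\<^sup>+ t. ennreal (ln (z + t)) \<partial>N) \<le> ennreal (ln z)"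
proof -
  interpret prob_space N by fact
  have phi': "integrable N (\<lambda>t. phi (max 0 t / z))"
  proof (rule Bochner_Integration.integrable_bound)
    show "integrable N (\<lambda>t. t / z)" using int by auto
    show "AE t in N. norm (phi (max 0 t / z)) \<le> norm (t / z)"
    proof (rule AE_I2)
      fix t
      have "0 \<le> phi (max 0 t / z)" using z by (intro phi_nonneg) auto
      moreover have "phi (max 0 t / z) \<le> max 0 t / z" using z by (intro phi_le) auto
      moreover have "max 0 t / z \<le> \<bar>t\<bar> / z" using z by (intro divide_right_mono) auto
      ultimately show "norm (phi (max 0 t / z)) \<le> norm (t / z)"
        using z by (simp add: abs_divide)
    qed
  qed measurable
  have "ennreal J \<le> ennreal (\<integral>t. phi (max 0 t / z) \<partial>N)"
    using J phi' z by (subst (asm) nn_integral_eq_integral) (auto intro!: phi_nonneg)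
  \<comment> \<open>A negative \<open>J\<close> is clipped to 0 by \<open>ennreal\<close>; a
    nonnegative integral still gives the real inequality in that case.\<close>
  moreover have "0 \<le> (\<integral>t. phi (max 0 t / z) \<partial>N)"
    using z by (intro integral_nonneg_AE AE_I2 phi_nonneg) auto
  ultimately have J': "J \<le> (\<integral>t. phi (max 0 t / z) \<partial>N)" by simp
  have pw: "AE t in N. 0 \<le> ln (z + t) \<and> ln (z + t) \<le> ln z + t / z - phi (max 0 t / z)"
    using range
  proof (rule AE_mp, intro AE_I2 impI)
    fix t assume t: "1 \<le> z + t"
    have "ln (z + t) = ln (z * (1 + t / z))" using z by (simp add: distrib_left)
    also have "0 < 1 + t / z" using z t by (simp add: field_simps)
    then have "ln (z * (1 + t / z)) = ln z + ln (1 + t / z)"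
      using z by (simp add: ln_mult)
    finally have "ln (z + t) = ln z + ln (1 + t / z)" .
    moreover have "ln (1 + t / z) \<le> t / z" using \<open>0 < 1 + t / z\<close> ln_add_one_self_le_self2[of "t / z"] by simp
    ultimately have "ln (z + t) \<le> ln z + t / z - phi (max 0 t / z)"
      by (cases "t \<ge> 0") (auto simp: phi_def max_def)
    then show "0 \<le> ln (z + t) \<and> ln (z + t) \<le> ln z + t / z - phi (max 0 t / z)"
      using t by simp
  qed
  have "(\<integral>\<^sup>+ t. ennreal (ln (z + t)) \<partial>N) \<le> (\<integral>\<^sup>+ t. ennreal (ln z + t / z - phi (max 0 t / z)) \<partial>N)"
    by (rule nn_integral_mono_AE, rule AE_mp[OF pw]) (auto intro!: ennreal_leI)
  also have "\<dots> = ennreal (\<integral>t. ln z + t / z - phi (max 0 t / z) \<partial>N)"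
  proof (rule nn_integral_eq_integral)
    show "integrable N (\<lambda>t. ln z + t / z - phi (max 0 t / z))" using int phi' by auto
    show "AE t in N. 0 \<le> ln z + t / z - phi (max 0 t / z)" by (rule AE_mp[OF pw]) auto
  qed
  also have "(\<integral>t. ln z + t / z - phi (max 0 t / z) \<partial>N) = ln z + (\<integral>t. t \<partial>N) / z - (\<integral>t. phi (max 0 t / z) \<partial>N)"
    using int phi' by (simp add: prob_space)
  also have "ennreal \<dots> \<le> ennreal (ln z)"
    using J' drift by (intro ennreal_leI) simp
  finally show ?thesis .
qed

text \<open>An exact second-order expansion of 1 / M around L, where M = 1 + ln (z + t). Upward
  jumps have M \<ge> L, so the quadratic term gains a factor 1 / L and is absorbed by
  \<open>phi\<close>. Downward jumps may bring M to 1, where nothing is gained from L; they are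
  charged to the last term, which carries no 1 / L^2.\<close>

lemma inverse_ln_expansion:
  assumes z: "1 \<le> z" and t: "1 \<le> z + t" and b: "1 < b" "b \<le> 2" and L: "L = 1 + ln z"
  shows "1 / (1 + ln (z + t))
    \<le> 1 / L + (- t / z + (1 + 2 / L) * phi (max 0 t / z)) / L\<^sup>2 + 8 * (neg_part t / z) powr b"
proof -
  define M where "M = 1 + ln (z + t)"
  have LM: "1 \<le> L" "1 \<le> M" using z t L by (auto simp: M_def)
  have pos: "0 < 1 + t / z" using z t by (simp add: field_simps)
  have "ln (z + t) = ln (z * (1 + t / z))" using z by (simp add: distrib_left)
  also have "\<dots> = ln z + ln (1 + t / z)"
    using z pos by (simp add: ln_mult)
  finally have D: "L - M = - ln (1 + t / z)" by (simp add: L M_def)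
  have L2: "1 \<le> L\<^sup>2" using LM by simp
  have recip: "1 / M = 1 / L + ((L - M) + (L - M)\<^sup>2 / M) / L\<^sup>2"
    using LM by (simp add: divide_simps) (simp add: power2_eq_square algebra_simps)
  show ?thesis
  proof (cases "t \<ge> 0")
    case True
    have u: "0 \<le> t / z" using True z by simp
    have le: "L \<le> M" using D ln_ge_zero[of "1 + t / z"] u by linarith
    have "(L - M)\<^sup>2 / M \<le> (L - M)\<^sup>2 / L"
      using LM le by (intro divide_left_mono) auto
    also have "\<dots> \<le> 2 * phi (t / z) / L"
      unfolding D using ln_squared_le_phi[OF u] LM by (intro divide_right_mono) auto
    finally have "(L - M)\<^sup>2 / M \<le> 2 * phi (t / z) / L" .
    moreover have "L - M = - t / z + phi (t / z)" unfolding D by (simp add: phi_def)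
    moreover have "(1 + 2 / L) * phi (t / z) = phi (t / z) + 2 * phi (t / z) / L" by (simp add: distrib_right)
    ultimately have "(L - M) + (L - M)\<^sup>2 / M \<le> - t / z + (1 + 2 / L) * phi (t / z)"
      by linarith
    then have "((L - M) + (L - M)\<^sup>2 / M) / L\<^sup>2 \<le> (- t / z + (1 + 2 / L) * phi (t / z)) / L\<^sup>2"
      by (rule divide_right_mono) simp
    moreover have "neg_part t = 0" "max 0 t = t" using True by (auto simp: neg_part_def)
    ultimately show ?thesis unfolding M_def[symmetric] recip by simp
  next
    case False
    define r where "r = - t / z"
    have r: "0 < r" "r < 1" using False z pos by (auto simp: r_def divide_less_0_iff)
    have rb: "r\<^sup>2 \<le> r powr b"
      using r b powr_mono'[of b 2 r] by (simp add: powr_numeral)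
    have n: "neg_part t / z = r" "max 0 t = 0" using False by (auto simp: neg_part_def r_def)
    have "1 / M \<le> 1 / L + r / L\<^sup>2 + 8 * r powr b"
    proof (cases "r \<le> 1 / 2")
      case True
      \<comment> \<open>For moderate jumps L - M is at most r + 2 * r^2 and also at most 2 * r;
        adding the square, at most 4 * r^2, yields r + 6 * r^2.\<close>
      have "- r - 2 * r\<^sup>2 \<le> ln (1 - r)" using r True by (intro ln_one_minus_pos_lower_bound) auto
      then have D1: "L - M \<le> r + 2 * r\<^sup>2" unfolding D by (simp add: r_def)
      have "2 * r\<^sup>2 \<le> r" using True r by (simp add: power2_eq_square)
      with D1 have D2: "L - M \<le> 2 * r" by simp
      have D0: "0 \<le> L - M" unfolding D using r by (simp add: r_def)
      have "(L - M)\<^sup>2 / M \<le> (L - M)\<^sup>2 / 1" using LM by (intro divide_left_mono) auto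
      also have "\<dots> \<le> (2 * r)\<^sup>2" using power_mono[OF D2 D0, of 2] by simp
      finally have "(L - M) + (L - M)\<^sup>2 / M \<le> r + 6 * r\<^sup>2" using D1 by (simp add: power_mult_distrib)
      then have "((L - M) + (L - M)\<^sup>2 / M) / L\<^sup>2 \<le> (r + 6 * r\<^sup>2) / L\<^sup>2"
        by (rule divide_right_mono) simp
      also have "\<dots> \<le> r / L\<^sup>2 + 6 * r\<^sup>2"
        using L2 by (simp add: add_divide_distrib divide_le_eq mult_le_cancel_left1)
      finally show ?thesis unfolding recip using rb powr_ge_zero[of r b] by linarith
    next
      case False
      \<comment> \<open>For a jump down by more than half of \<open>z\<close> the trivial bound is
        enough, since 8 * r^2 exceeds 1.\<close>
      have "1 / M \<le> 1" using LM by simp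
      also have "1 \<le> 8 * r\<^sup>2" using False power_mono[of "1/2" r 2] by (simp add: power2_eq_square)
      also have "\<dots> \<le> 8 * r powr b" using rb by simp
      also have "\<dots> \<le> 1 / L + r / L\<^sup>2 + 8 * r powr b" using LM r by simp
      finally show ?thesis .
    qed
    then show ?thesis unfolding M_def[symmetric] n by (simp add: phi_def r_def)
  qed
qed

text \<open>The drift hypothesis is the integrated expansion multiplied by L^2, hence the L^2 beside
  the negative moment. In the application b > \<alpha> makes that term o(z powr - \<alpha>).\<close>

lemma inverse_ln_supermartingale_step:
  assumes "prob_space N" and [measurable_cong]: "sets N = sets borel" and z: "1 \<le> z"
    and range: "AE t in N. 1 \<le> z + t" and int: "integrable N (\<lambda>t. t)" and b: "1 < b" "b \<le> 2"
    and L: "L = 1 + ln z" and "0 \<le> J" "0 \<le> B"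
    and J: "(\<integral>\<^sup>+ t. ennreal (phi (max 0 t / z)) \<partial>N) \<le> ennreal J"
    and B: "(\<integral>\<^sup>+ t. ennreal (neg_part t powr b) \<partial>N) \<le> ennreal B"
    and drift: "(1 + 2 / L) * J + 8 * B * L\<^sup>2 * z powr - b \<le> (\<integral>t. t \<partial>N) / z"
  shows "(\<integral>\<^sup>+ t. ennreal (1 / (1 + ln (z + t))) \<partial>N) \<le> ennreal (1 / L)"
proof -
  interpret prob_space N by fact
  have L1: "1 \<le> L" using z L by simp
  have phi': "integrable N (\<lambda>t. phi (max 0 t / z))"
    using J z by (intro integrableI_nonneg) (auto intro!: phi_nonneg simp: le_less_trans)
  have J': "(\<integral>t. phi (max 0 t / z) \<partial>N) \<le> J"
    using J phi' z \<open>0 \<le> J\<close> by (subst (asm) nn_integral_eq_integral) (auto intro!: phi_nonneg)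
  have neg': "integrable N (\<lambda>t. neg_part t powr b)"
    using B by (intro integrableI_nonneg) (auto simp: le_less_trans)
  have B': "(\<integral>t. neg_part t powr b \<partial>N) \<le> B"
    using B neg' \<open>0 \<le> B\<close> by (subst (asm) nn_integral_eq_integral) auto
  have scale: "(neg_part t / z) powr b = z powr - b * neg_part t powr b" for t
  proof -
    have "(neg_part t / z) powr b = neg_part t powr b / z powr b"
      by (rule powr_divide)
    then show ?thesis by (simp add: powr_minus divide_inverse mult.commute)
  qed
  let ?g = "\<lambda>t. 1 / L + (- t / z + (1 + 2 / L) * phi (max 0 t / z)) / L\<^sup>2 + 8 * (neg_part t / z) powr b"
  have pw: "AE t in N. 0 \<le> 1 / (1 + ln (z + t)) \<and> 1 / (1 + ln (z + t)) \<le> ?g t"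
    using range by (rule AE_mp) (use inverse_ln_expansion[OF z _ b L] in auto)
  have ig: "integrable N ?g"
    unfolding scale using int phi' neg' by auto
  have "(\<integral>\<^sup>+ t. ennreal (1 / (1 + ln (z + t))) \<partial>N) \<le> (\<integral>\<^sup>+ t. ennreal (?g t) \<partial>N)"
    by (rule nn_integral_mono_AE, rule AE_mp[OF pw]) (auto intro!: ennreal_leI)
  also have "\<dots> = ennreal (\<integral>t. ?g t \<partial>N)"
    by (rule nn_integral_eq_integral[OF ig], rule AE_mp[OF pw])
       (intro AE_I2 impI, elim conjE, erule (1) order_trans)
  also have "(\<integral>t. ?g t \<partial>N) = 1 / L + (- (\<integral>t. t \<partial>N) / z + (1 + 2 / L) * (\<integral>t. phi (max 0 t / z) \<partial>N)) / L\<^sup>2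
      + 8 * (z powr - b * (\<integral>t. neg_part t powr b \<partial>N))"
    unfolding scale using int phi' neg' by (simp add: prob_space)
  also have "\<dots> \<le> 1 / L"
  proof -
    have "(1 + 2 / L) * (\<integral>t. phi (max 0 t / z) \<partial>N) \<le> (1 + 2 / L) * J"
      using J' L1 by (intro mult_left_mono) auto
    moreover have "L\<^sup>2 * (8 * (z powr - b * (\<integral>t. neg_part t powr b \<partial>N))) \<le> L\<^sup>2 * (8 * (z powr - b * B))"
      using B' by (intro mult_left_mono) auto
    ultimately have "(- (\<integral>t. t \<partial>N) / z + (1 + 2 / L) * (\<integral>t. phi (max 0 t / z) \<partial>N))
        + L\<^sup>2 * (8 * (z powr - b * (\<integral>t. neg_part t powr b \<partial>N))) \<le> 0"
      using drift by (simp add: algebra_simps)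
    then have "((- (\<integral>t. t \<partial>N) / z + (1 + 2 / L) * (\<integral>t. phi (max 0 t / z) \<partial>N))
        + L\<^sup>2 * (8 * (z powr - b * (\<integral>t. neg_part t powr b \<partial>N)))) / L\<^sup>2 \<le> 0"
      by (intro divide_nonpos_nonneg) auto
    then show ?thesis using L1 by (simp add: add_divide_distrib)
  qed
  finally show ?thesis by (simp add: ennreal_leI)
qed

section \<open>One-step drift of power functions\<close>

lemma powr_subadditive:
  fixes a b q :: real
  assumes ab: "0 \<le> a" "0 \<le> b" and q: "0 < q" "q \<le> 1"
  shows "(a + b) powr q \<le> a powr q + b powr q"
proof (cases "a + b = 0")
  case False
  then have s: "0 < a + b" using ab by simp
  \<comment> \<open>A fraction in [0, 1] is at most its \<open>q\<close>-th power; this is used for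
    a / (a + b) and b / (a + b), which sum to 1.\<close>
  have part: "c / (a + b) * (a + b) powr q \<le> c powr q" if c: "0 \<le> c" "c \<le> a + b" for c
  proof -
    have "(c / (a + b)) powr 1 \<le> (c / (a + b)) powr q"
      using c s q by (intro powr_mono') auto
    then have "c / (a + b) * (a + b) powr q \<le> (c / (a + b)) powr q * (a + b) powr q"
      using c s by (intro mult_right_mono) auto
    also have "\<dots> = c powr q" using c s by (simp add: powr_divide)
    finally show ?thesis .
  qed
  have "(a + b) powr q = a / (a + b) * (a + b) powr q + b / (a + b) * (a + b) powr q"
    using s by (simp flip: distrib_right add_divide_distrib)
  also have "\<dots> \<le> a powr q + b powr q"
    using ab by (intro add_mono part) auto
  finally show ?thesis .
qed simp

lemma powr_mvt:
  fixes a b p :: real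
  assumes "0 \<le> a" "a < b" "1 < p"
  obtains s where "a < s" "s < b" "b powr p - a powr p = p * s powr (p - 1) * (b - a)"
proof -
  have "continuous_on {a..b} (\<lambda>s. s powr p)"
    using assms by (intro continuous_on_powr' continuous_intros) auto
  moreover have "((\<lambda>s. s powr p) has_derivative (\<lambda>h. p * s powr (p - 1) * h)) (at s)" if "a < s" "s < b" for s
  proof -
    have "((\<lambda>s. s powr p) has_real_derivative p * s powr (p - 1)) (at s)"
      using that assms by (intro has_real_derivative_powr) auto
    then show ?thesis by (simp add: has_field_derivative_def)
  qed
  ultimately show ?thesis
    using mvt[of a b "\<lambda>s. s powr p" "\<lambda>s h. p * s powr (p - 1) * h"] assms(2) that by blast
qed

text \<open>Mean value theorem, with the derivative at the intermediate point compared to that at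
  \<open>x\<close> by subadditivity of the power p - 1 \<le> 1. The remainder depends on the
  increment alone, so a bounded moment controls it uniformly in \<open>x\<close>.\<close>

lemma powr_taylor_bound:
  fixes x y p :: real
  assumes x: "0 < x" and y: "0 \<le> y" and p: "1 < p" "p \<le> 2"
  shows "y powr p \<le> x powr p + p * x powr (p - 1) * (y - x) + p * \<bar>y - x\<bar> powr p"
proof (cases "y = x")
  case False
  have base: "\<bar>y - x\<bar> powr (p - 1) * \<bar>y - x\<bar> = \<bar>y - x\<bar> powr p"
    using powr_mult_base[of "\<bar>y - x\<bar>" "p - 1"] by (simp add: mult.commute)
  consider "x < y" | "y < x" using False by linarith
  then show ?thesis
  proof cases
    case 1
    obtain s where s: "x < s" "s < y" "y powr p - x powr p = p * s powr (p - 1) * (y - x)"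
      using powr_mvt[of x y p] x 1 p by auto
    have "s powr (p - 1) \<le> x powr (p - 1) + (s - x) powr (p - 1)"
      using powr_subadditive[of x "s - x" "p - 1"] x s p by simp
    also have "(s - x) powr (p - 1) \<le> \<bar>y - x\<bar> powr (p - 1)"
      using s p by (intro powr_mono2) auto
    finally have "p * s powr (p - 1) * (y - x) \<le> p * (x powr (p - 1) + \<bar>y - x\<bar> powr (p - 1)) * (y - x)"
      using 1 p by (intro mult_right_mono mult_left_mono) auto
    also have "\<dots> = p * x powr (p - 1) * (y - x) + p * \<bar>y - x\<bar> powr p"
      using 1 base by (simp add: distrib_left distrib_right mult.assoc)
    finally show ?thesis using s(3) by simp
  next
    case 2
    obtain s where s: "y < s" "s < x" "x powr p - y powr p = p * s powr (p - 1) * (x - y)"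
      using powr_mvt[of y x p] y 2 p by auto
    have "x powr (p - 1) \<le> s powr (p - 1) + (x - s) powr (p - 1)"
      using powr_subadditive[of s "x - s" "p - 1"] y s p by simp
    also have "(x - s) powr (p - 1) \<le> \<bar>y - x\<bar> powr (p - 1)"
      using s p by (intro powr_mono2) auto
    finally have "x powr (p - 1) - \<bar>y - x\<bar> powr (p - 1) \<le> s powr (p - 1)" by simp
    then have "p * (x powr (p - 1) - \<bar>y - x\<bar> powr (p - 1)) * (x - y) \<le> p * s powr (p - 1) * (x - y)"
      using 2 p by (intro mult_right_mono mult_left_mono) auto
    moreover have "p * (x powr (p - 1) - \<bar>y - x\<bar> powr (p - 1)) * (x - y) = p * x powr (p - 1) * (x - y) - p * \<bar>y - x\<bar> powr p"
      using 2 base by (simp add: right_diff_distrib[of p] left_diff_distrib[of _ _ "x - y"] mult.assoc)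
    moreover have "p * x powr (p - 1) * (x - y) = - (p * x powr (p - 1) * (y - x))"
      by (simp add: right_diff_distrib)
    ultimately show ?thesis using s(3) by linarith
  qed
qed simp

text \<open>Raising the exponent from \<open>p\<close> to \<alpha> turns the expected Taylor
  remainder into at most p * (1 + B); the drift hypothesis asks the linear term to beat this by
  1.\<close>

lemma powr_supermartingale_step:
  assumes "prob_space N" and [measurable_cong]: "sets N = sets borel" and x: "0 < x"
    and range: "AE t in N. 0 \<le> x + t" and p: "1 < p" "p \<le> \<alpha>" "\<alpha> \<le> 2" and "0 \<le> B"
    and B: "(\<integral>\<^sup>+ t. ennreal (\<bar>t\<bar> powr \<alpha>) \<partial>N) \<le> ennreal B"
    and drift: "p * x powr (p - 1) * (\<integral>t. t \<partial>N) + p * (1 + B) \<le> - 1"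
  shows "1 + (\<integral>\<^sup>+ t. ennreal ((x + t) powr p) \<partial>N) \<le> ennreal (x powr p)"
proof -
  interpret prob_space N by fact
  have B1: "integrable N (\<lambda>t. \<bar>t\<bar> powr \<alpha>)"
    using B by (intro integrableI_nonneg) (auto simp: le_less_trans)
  have B2: "(\<integral>t. \<bar>t\<bar> powr \<alpha> \<partial>N) \<le> B"
    using B B1 \<open>0 \<le> B\<close> by (subst (asm) nn_integral_eq_integral) auto
  have int: "integrable N (\<lambda>t. t)"
  proof (rule Bochner_Integration.integrable_bound)
    show "integrable N (\<lambda>t. 1 + \<bar>t\<bar> powr \<alpha>)" using B1 by auto
    show "AE t in N. norm t \<le> norm (1 + \<bar>t\<bar> powr \<alpha>)"
    proof (rule AE_I2)
      fix t
      show "norm t \<le> norm (1 + \<bar>t\<bar> powr \<alpha>)"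
        using le_one_plus_powr[of "\<bar>t\<bar>" 1 \<alpha>] p by simp
    qed
  qed measurable
  let ?g = "\<lambda>t. x powr p + p * x powr (p - 1) * t + p * (1 + \<bar>t\<bar> powr \<alpha>)"
  have pw: "AE t in N. (x + t) powr p \<le> ?g t"
    using range
  proof (rule AE_mp, intro AE_I2 impI)
    fix t assume t: "0 \<le> x + t"
    have "(x + t) powr p \<le> x powr p + p * x powr (p - 1) * t + p * \<bar>t\<bar> powr p"
      using powr_taylor_bound[OF x t] p by simp
    also have "p * \<bar>t\<bar> powr p \<le> p * (1 + \<bar>t\<bar> powr \<alpha>)"
      using p by (intro mult_left_mono le_one_plus_powr) auto
    finally show "(x + t) powr p \<le> ?g t" by simp
  qed
  have ig: "integrable N ?g" using int B1 by auto
  have "(\<integral>\<^sup>+ t. ennreal ((x + t) powr p) \<partial>N) \<le> (\<integral>\<^sup>+ t. ennreal (?g t) \<partial>N)"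
    by (rule nn_integral_mono_AE, rule AE_mp[OF pw]) (auto intro!: ennreal_leI)
  also have "\<dots> = ennreal (\<integral>t. ?g t \<partial>N)"
    by (rule nn_integral_eq_integral[OF ig], rule AE_mp[OF pw]) (intro AE_I2 impI, erule order_trans[OF powr_ge_zero])
  also have "(\<integral>t. ?g t \<partial>N) = x powr p + p * x powr (p - 1) * (\<integral>t. t \<partial>N) + p * (1 + (\<integral>t. \<bar>t\<bar> powr \<alpha> \<partial>N))"
    using int B1 by (simp add: prob_space)
  also have "ennreal \<dots> \<le> ennreal (x powr p - 1)"
  proof (rule ennreal_leI)
    have "p * (1 + (\<integral>t. \<bar>t\<bar> powr \<alpha> \<partial>N)) \<le> p * (1 + B)"
      using B2 p by (intro mult_left_mono) auto
    then show "x powr p + p * x powr (p - 1) * (\<integral>t. t \<partial>N) + p * (1 + (\<integral>t. \<bar>t\<bar> powr \<alpha> \<partial>N)) \<le> x powr p - 1"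
      using drift by simp
  qed
  finally have le: "(\<integral>\<^sup>+ t. ennreal ((x + t) powr p) \<partial>N) \<le> ennreal (x powr p - 1)" .
  \<comment> \<open>Adding 1 back to \<open>ennreal (x powr p - 1)\<close> requires
    \<open>1 \<le> x powr p\<close>, as \<open>ennreal\<close> clips negative values. From x + t
    \<ge> 0 the mean is at least - x, and the drift hypothesis then forces 1 + B \<le> x powr
    p.\<close>
  have "- x = (\<integral>t. - x \<partial>N)" by (simp add: prob_space)
  also have "\<dots> \<le> (\<integral>t. t \<partial>N)"
    by (rule integral_mono_AE) (use int range in auto)
  finally have "p * x powr (p - 1) * (- x) \<le> p * x powr (p - 1) * (\<integral>t. t \<partial>N)"
    using p by (intro mult_left_mono) auto
  moreover have "x powr (p - 1) * x = x powr p"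
    using x powr_mult_base[of x "p - 1"] by (simp add: mult.commute)
  ultimately have "p * (1 + B) \<le> p * x powr p"
    using drift by (simp add: mult.assoc)
  then have "1 \<le> x powr p"
    using p \<open>0 \<le> B\<close> by simp
  then have "1 + ennreal (x powr p - 1) = ennreal (x powr p)"
    by (simp flip: ennreal_1 ennreal_plus)
  then show ?thesis using le by (metis add_left_mono)
qed

section \<open>Recurrence and transience\<close>

context chain
begin

section \<open>The law of one increment and the tail condition\<close>

lemma
  assumes x: "x \<in> X"
  shows prob_space_increment: "prob_space (distr (P x) borel theta)"
    and nn_integral_increment: "f \<in> borel_measurable borel \<Longrightarrow>
      (\<integral>\<^sup>+ y. f y \<partial>K x) = (\<integral>\<^sup>+ t. f (x + t) \<partial>distr (P x) borel theta)"
    and AE_increment: "AE t in distr (P x) borel theta. 0 \<le> x + t"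
    and drift_increment: "(\<integral>t. t \<partial>distr (P x) borel theta) = drift P x"
proof -
  show "prob_space (distr (P x) borel theta)"
    by (rule prob_space.prob_space_distr[OF prob_space_P]) measurable
  show "(\<integral>\<^sup>+ y. f y \<partial>K x) = (\<integral>\<^sup>+ t. f (x + t) \<partial>distr (P x) borel theta)" if "f \<in> borel_measurable borel"
    unfolding distr_theta[OF x] using that by (subst nn_integral_distr) auto
  show "AE t in distr (P x) borel theta. 0 \<le> x + t"
    unfolding distr_theta[OF x]
    by (subst AE_distr_iff) (use AE_K_X[OF x] X_nonneg in auto)
  show "(\<integral>t. t \<partial>distr (P x) borel theta) = drift P x"
    unfolding drift_def by (rule integral_distr) measurable
qed

lemma measure_increment_tail:
  assumes "0 \<le> y"
  shows "measure (distr (P x) borel theta) {y<..} = measure (P x) {\<omega> \<in> space traj. pos_part (theta \<omega>) > y}"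
proof -
  have "theta -` {y<..} \<inter> space (P x) = {\<omega> \<in> space traj. pos_part (theta \<omega>) > y}"
    using assms by (auto simp: pos_part_def)
  then show ?thesis by (subst measure_distr) auto
qed

text \<open>Slack on both sides of \<open>c\<close> turns the uniform limit into power bounds valid
  from a single \<open>Y\<close> on. Taking it at least 1 keeps \<open>y\<close> positive, so that
  \<open>y powr \<alpha>\<close> can be moved across.\<close>

lemma cond_T_tails:
  assumes T: "cond_T X P \<alpha> \<beta> c x0" and c: "c1 < c" "c < c2"
  shows "\<exists>Y>0. \<forall>x\<in>X. x0 \<le> x \<longrightarrow> (\<forall>y\<ge>Y. c1 * y powr - \<alpha> \<le> measure (distr (P x) borel theta) {y<..} \<and>
    measure (distr (P x) borel theta) {y<..} \<le> c2 * y powr - \<alpha>)"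
proof -
  define \<epsilon> where "\<epsilon> = min (c - c1) (c2 - c)"
  have "0 < \<epsilon>" using c by (simp add: \<epsilon>_def)
  then obtain Y where Y: "\<And>x y. x \<in> X \<Longrightarrow> x0 \<le> x \<Longrightarrow> Y \<le> y \<Longrightarrow>
      \<bar>y powr \<alpha> * measure (P x) {\<omega> \<in> space traj. pos_part (theta \<omega>) > y} - c\<bar> \<le> \<epsilon>"
    using T unfolding cond_T_def by blast
  show ?thesis
  proof (intro exI[of _ "max 1 Y"] conjI ballI allI impI)
    fix x y assume "x \<in> X" "x0 \<le> x" and y: "max 1 Y \<le> y"
    define m where "m = measure (distr (P x) borel theta) {y<..}"
    have "\<bar>y powr \<alpha> * m - c\<bar> \<le> \<epsilon>"
      using Y[of x y] \<open>x \<in> X\<close> \<open>x0 \<le> x\<close> y by (simp add: m_def measure_increment_tail del: space_traj)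
    then have b: "c1 \<le> y powr \<alpha> * m" "y powr \<alpha> * m \<le> c2"
      unfolding \<epsilon>_def by linarith+
    have e: "y powr \<alpha> * m * y powr - \<alpha> = m"
      using y powr_add[of y \<alpha> "- \<alpha>"] by (simp add: mult.assoc mult.left_commute)
    show "c1 * y powr - \<alpha> \<le> m" "m \<le> c2 * y powr - \<alpha>"
      using mult_right_mono[OF b(1), of "y powr - \<alpha>"] mult_right_mono[OF b(2), of "y powr - \<alpha>"] e by simp_all
  qed simp
qed

lemma cond_T_neg_moment:
  assumes "cond_T X P \<alpha> \<beta> c x0"
  obtains B where "0 \<le> B" "\<And>x. x \<in> X \<Longrightarrow> x0 \<le> x \<Longrightarrow>
    (\<integral>\<^sup>+ t. ennreal (neg_part t powr \<beta>) \<partial>distr (P x) borel theta) \<le> ennreal B"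
proof -
  obtain B where B: "\<And>x. x \<in> X \<Longrightarrow> x0 \<le> x \<Longrightarrow>
      (\<integral>\<^sup>+ \<omega>. ennreal (neg_part (theta \<omega>) powr \<beta>) \<partial>P x) \<le> ennreal B"
    using assms unfolding cond_T_def by blast
  show ?thesis
  proof (rule that[of "max 0 B"])
    fix x assume "x \<in> X" "x0 \<le> x"
    then show "(\<integral>\<^sup>+ t. ennreal (neg_part t powr \<beta>) \<partial>distr (P x) borel theta) \<le> ennreal (max 0 B)"
      using order_trans[OF B ennreal_leI[of B "max 0 B"]] by (subst nn_integral_distr) auto
  qed simp
qed

lemma cond_T_csc_pos:
  assumes "cond_T X P \<alpha> \<beta> c x0"
  shows "0 < pi * \<bar>1 / sin (pi * \<alpha>)\<bar>"
proof -
  have "1 < \<alpha>" "\<alpha> < 2" using assms by (auto simp: cond_T_def)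
  then show ?thesis by (subst abs_csc_eq_Gamma) (auto intro!: mult_pos_pos Gamma_real_pos)
qed

text \<open>One fixed scale \<open>Z\<close> and any tail constant above \<open>c\<close>, here c +
  1, give a finite expectation of \<open>phi\<close>, which together with the negative moment yields
  integrability.\<close>

lemma cond_T_integrable:
  assumes T: "cond_T X P \<alpha> \<beta> c x0"
  shows "\<exists>A. \<forall>x\<in>X. A \<le> x \<longrightarrow> integrable (distr (P x) borel theta) (\<lambda>t. t)"
proof -
  have \<alpha>: "1 < \<alpha>" "\<alpha> < 2" "\<alpha> < \<beta>" "0 < c" using T by (auto simp: cond_T_def)
  obtain Y where Y: "0 < Y" "\<And>x y. x \<in> X \<Longrightarrow> x0 \<le> x \<Longrightarrow> Y \<le> y \<Longrightarrow>
      measure (distr (P x) borel theta) {y<..} \<le> (c + 1) * y powr - \<alpha>"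
    using cond_T_tails[OF T \<alpha>(4), of "c + 1"] by auto
  have "\<exists>Z>0. \<forall>z\<ge>Z. \<forall>N. prob_space N \<longrightarrow> sets N = sets borel \<longrightarrow>
    (\<forall>y\<ge>Y. measure N {y<..} \<le> (c + 1) * y powr - \<alpha>) \<longrightarrow>
    (\<integral>\<^sup>+ t. ennreal (phi (max 0 t / z)) \<partial>N) \<le> ennreal (((c + 1) * (pi * \<bar>1 / sin (pi * \<alpha>)\<bar>) + 1) * z powr - \<alpha>)"
    using \<alpha> Y(1) by (intro phi_expectation_upper) auto
  then obtain Z where Z: "0 < Z" "\<And>N. prob_space N \<Longrightarrow> sets N = sets borel \<Longrightarrow>
    (\<forall>y\<ge>Y. measure N {y<..} \<le> (c + 1) * y powr - \<alpha>) \<Longrightarrow>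
    (\<integral>\<^sup>+ t. ennreal (phi (max 0 t / Z)) \<partial>N) \<le> ennreal (((c + 1) * (pi * \<bar>1 / sin (pi * \<alpha>)\<bar>) + 1) * Z powr - \<alpha>)"
    by blast
  obtain B where B: "0 \<le> B" "\<And>x. x \<in> X \<Longrightarrow> x0 \<le> x \<Longrightarrow>
    (\<integral>\<^sup>+ t. ennreal (neg_part t powr \<beta>) \<partial>distr (P x) borel theta) \<le> ennreal B"
    using cond_T_neg_moment[OF T] by blast
  show ?thesis
  proof (intro exI[of _ x0] ballI impI)
    fix x assume x: "x \<in> X" "x0 \<le> x"
    show "integrable (distr (P x) borel theta) (\<lambda>t. t)"
    proof (rule integrable_increment[OF prob_space_increment[OF x(1)] _ Z(1)])
      show "(\<integral>\<^sup>+ t. ennreal (phi (max 0 t / Z)) \<partial>distr (P x) borel theta) < \<infinity>"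
        by (rule le_less_trans[OF Z(2)]) (use x Y prob_space_increment in auto)
      show "(\<integral>\<^sup>+ t. ennreal (neg_part t powr \<beta>) \<partial>distr (P x) borel theta) < \<infinity>"
        by (rule le_less_trans[OF B(2)]) (use x in auto)
    qed (use \<alpha> in auto)
  qed
qed

section \<open>Verification of the Lyapunov inequalities far out\<close>

lemma eventually_at_top_in:
  "eventually Q (at_top_in X) \<longleftrightarrow> (\<exists>A. \<forall>x\<in>X. A \<le> x \<longrightarrow> Q x)"
  by (auto simp: at_top_in_def eventually_inf_principal eventually_at_top_linorder)

text \<open>Three margins separate the limsup from c * I: k1 < k pays for replacing x by z = 1 + x,
  k < c' * I for the convergence of the expectation of \<open>phi\<close>, and c' < c for the
  uniform tail limit.\<close>

lemma recurrent_if_small_drift: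
  assumes N: "cond_N X P" and T: "cond_T X P \<alpha> \<beta> c x0"
    and lim: "Limsup (at_top_in X) (\<lambda>x. ereal (x powr (\<alpha> - 1) * drift P x)) < ereal (c * pi * \<bar>1 / sin (pi * \<alpha>)\<bar>)"
  shows "recurrent X P"
proof -
  define I where "I = pi * \<bar>1 / sin (pi * \<alpha>)\<bar>"
  have \<alpha>: "1 < \<alpha>" "\<alpha> < 2" and c: "0 < c" using T by (auto simp: cond_T_def)
  have I: "0 < I" unfolding I_def by (rule cond_T_csc_pos[OF T])
  obtain k0 where k0: "Limsup (at_top_in X) (\<lambda>x. ereal (x powr (\<alpha> - 1) * drift P x)) < ereal k0" "k0 < c * I"
    using ereal_dense2[OF lim] by (auto simp: I_def mult.assoc)
  have "eventually (\<lambda>x. ereal (x powr (\<alpha> - 1) * drift P x) < ereal k0) (at_top_in X)"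
    using k0(1) by (rule Limsup_lessD)
  then obtain A0 where A0: "\<And>x. x \<in> X \<Longrightarrow> A0 \<le> x \<Longrightarrow> x powr (\<alpha> - 1) * drift P x < k0"
    by (auto simp: eventually_at_top_in)
  \<comment> \<open>The drift may be negative, while the lower bound on the expectation of
    \<open>phi\<close> is stated for nonnegative constants.\<close>
  define k1 where "k1 = max k0 0"
  have k1: "0 \<le> k1" "k1 < c * I" using k0 c I by (auto simp: k1_def)
  obtain k where k: "k1 < k" "k < c * I" using dense[OF k1(2)] by blast
  have "k / I < c" using k I by (simp add: divide_less_eq)
  then obtain c' where c': "k / I < c'" "c' < c" using dense by blast
  have "0 < k / I" using k k1 I by simp
  then have "0 < c'" using c' by simp
  have kc': "k < c' * I" using c' I by (simp add: divide_less_eq)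
  obtain Y where Y: "0 < Y" "\<And>x y. x \<in> X \<Longrightarrow> x0 \<le> x \<Longrightarrow> Y \<le> y \<Longrightarrow>
      c' * y powr - \<alpha> \<le> measure (distr (P x) borel theta) {y<..}"
    using cond_T_tails[OF T c'(2), of "c + 1"] by auto
  have "\<exists>Z>0. \<forall>z\<ge>Z. \<forall>N. prob_space N \<longrightarrow> sets N = sets borel \<longrightarrow>
    (\<forall>y\<ge>Y. c' * y powr - \<alpha> \<le> measure N {y<..}) \<longrightarrow>
    ennreal (k * z powr - \<alpha>) \<le> (\<integral>\<^sup>+ t. ennreal (phi (max 0 t / z)) \<partial>N)"
    using \<alpha> Y(1) \<open>0 < c'\<close> k k1 kc' by (intro phi_expectation_lower) (auto simp: I_def)
  then obtain Z where Z: "\<And>z N. Z \<le> z \<Longrightarrow> prob_space N \<Longrightarrow> sets N = sets borel \<Longrightarrow>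
    (\<forall>y\<ge>Y. c' * y powr - \<alpha> \<le> measure N {y<..}) \<Longrightarrow>
    ennreal (k * z powr - \<alpha>) \<le> (\<integral>\<^sup>+ t. ennreal (phi (max 0 t / z)) \<partial>N)"
    by blast
  obtain A1 where A1: "\<And>x. x \<in> X \<Longrightarrow> A1 \<le> x \<Longrightarrow> integrable (distr (P x) borel theta) (\<lambda>t. t)"
    using cond_T_integrable[OF T] by blast
  \<comment> \<open>The hypothesis is scaled by powers of x, the Lyapunov estimate by powers of z =
    1 + x; the ratio tends to 1 and uses up the margin between k1 and k.\<close>
  have "((\<lambda>x. k1 * ((1 + x) / x) powr (\<alpha> - 1)) \<longlongrightarrow> k1) at_top"
    by real_asymp
  then have "eventually (\<lambda>x. k1 * ((1 + x) / x) powr (\<alpha> - 1) < k) at_top"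
    using k by (intro order_tendstoD) auto
  then obtain A2 where A2: "\<And>x. A2 \<le> x \<Longrightarrow> k1 * ((1 + x) / x) powr (\<alpha> - 1) < k"
    by (auto simp: eventually_at_top_linorder)
  define A where "A = Max {0, x0, A0, A1, A2, Z}"
  have A: "0 \<le> A" "x0 \<le> A" "A0 \<le> A" "A1 \<le> A" "A2 \<le> A" "Z \<le> A" by (auto simp: A_def)
  show ?thesis
  \<comment> \<open>\<open>max 0 x\<close> extends the function monotonically to the whole line and
    agrees with \<open>x\<close> on \<open>X\<close>.\<close>
  proof (rule recurrent_criterion[OF N, of "\<lambda>x. ennreal (ln (1 + max 0 x))" A])
    show "mono (\<lambda>x. ennreal (ln (1 + max 0 x)))"
      by (intro monoI ennreal_leI) auto
    have "filterlim (\<lambda>x::real. ln (1 + max 0 x)) at_top at_top"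
      by real_asymp
    then show "((\<lambda>x. ennreal (ln (1 + max 0 x))) \<longlongrightarrow> \<infinity>) at_top"
      by (simp add: ennreal_tendsto_top_eq_at_top)
    fix x assume x: "x \<in> X" "A < x"
    define z where "z = 1 + x"
    have x0: "0 < x" "1 \<le> z" "z > 0" using x A by (auto simp: z_def)
    interpret D: prob_space "distr (P x) borel theta" by (rule prob_space_increment[OF x(1)])
    have "(\<integral>\<^sup>+ y. ennreal (ln (1 + max 0 y)) \<partial>K x)
      = (\<integral>\<^sup>+ t. ennreal (ln (1 + max 0 (x + t))) \<partial>distr (P x) borel theta)"
      by (rule nn_integral_increment[OF x(1)]) measurable
    also have "\<dots> = (\<integral>\<^sup>+ t. ennreal (ln (z + t)) \<partial>distr (P x) borel theta)"
      by (rule nn_integral_cong_AE, rule AE_mp[OF AE_increment[OF x(1)]]) (auto simp: z_def max_def add.assoc)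
    also have "\<dots> \<le> ennreal (ln z)"
    proof (rule ln_supermartingale_step[where J = "k * z powr - \<alpha>"])
      show "AE t in distr (P x) borel theta. 1 \<le> z + t"
        using AE_increment[OF x(1)] by (rule AE_mp) (auto simp: z_def)
      show "integrable (distr (P x) borel theta) (\<lambda>t. t)" using A1 x A by auto
      show "ennreal (k * z powr - \<alpha>) \<le> (\<integral>\<^sup>+ t. ennreal (phi (max 0 t / z)) \<partial>distr (P x) borel theta)"
        by (rule Z) (use x A Y D.prob_space_axioms in \<open>auto simp: z_def\<close>)
      have "x powr (\<alpha> - 1) * drift P x \<le> k1" using A0[of x] x A by (simp add: k1_def)
      then have "(z / x) powr (\<alpha> - 1) * (x powr (\<alpha> - 1) * drift P x) \<le> (z / x) powr (\<alpha> - 1) * k1"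
        by (intro mult_left_mono) auto
      also have "\<dots> \<le> k" using A2[of x] x A by (simp add: z_def mult.commute)
      also have "(z / x) powr (\<alpha> - 1) * (x powr (\<alpha> - 1) * drift P x) = z powr (\<alpha> - 1) * drift P x"
        using x0 by (simp add: powr_divide)
      finally have "z powr (\<alpha> - 1) * drift P x * z powr - \<alpha> \<le> k * z powr - \<alpha>"
        by (intro mult_right_mono) auto
      moreover have "z powr (\<alpha> - 1) * z powr - \<alpha> = 1 / z"
        using x0 powr_add[of z "\<alpha> - 1" "- \<alpha>"] by (simp add: powr_minus_divide)
      ultimately show "(\<integral>t. t \<partial>distr (P x) borel theta) / z \<le> k * z powr - \<alpha>"
        unfolding drift_increment[OF x(1)] by (simp add: mult.assoc mult.left_commute)
    qed (use x0 D.prob_space_axioms in auto)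
    also have "ennreal (ln z) = ennreal (ln (1 + max 0 x))" using x0 by (simp add: z_def)
    finally show "(\<integral>\<^sup>+ y. ennreal (ln (1 + max 0 y)) \<partial>K x) \<le> ennreal (ln (1 + max 0 x))" .
  qed (use A in auto)
qed

text \<open>The margins are mirrored: c < c', c' * I < k and k < k0. The last one absorbs the factor
  1 + 2 / L and the downward jumps, two corrections that fade as z grows.\<close>

lemma transient_if_large_drift:
  assumes N: "cond_N X P" and T: "cond_T X P \<alpha> \<beta> c x0"
    and lim: "Liminf (at_top_in X) (\<lambda>x. ereal (x powr (\<alpha> - 1) * drift P x)) > ereal (c * pi * \<bar>1 / sin (pi * \<alpha>)\<bar>)"
  shows "transient X P"
proof -
  define I where "I = pi * \<bar>1 / sin (pi * \<alpha>)\<bar>"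
  have \<alpha>: "1 < \<alpha>" "\<alpha> < 2" "\<alpha> < \<beta>" and c: "0 < c" using T by (auto simp: cond_T_def)
  have I: "0 < I" unfolding I_def by (rule cond_T_csc_pos[OF T])
  obtain k0 where k0: "c * I < k0" "ereal k0 < Liminf (at_top_in X) (\<lambda>x. ereal (x powr (\<alpha> - 1) * drift P x))"
    using ereal_dense2[OF lim] by (auto simp: I_def mult.assoc)
  have "eventually (\<lambda>x. ereal k0 < ereal (x powr (\<alpha> - 1) * drift P x)) (at_top_in X)"
    using k0(2) by (rule less_LiminfD)
  then obtain A0 where A0: "\<And>x. x \<in> X \<Longrightarrow> A0 \<le> x \<Longrightarrow> k0 < x powr (\<alpha> - 1) * drift P x"
    by (auto simp: eventually_at_top_in)
  obtain k where k: "c * I < k" "k < k0" using dense[OF k0(1)] by blast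
  have "0 < c * I" using c I by simp
  have "c < k / I" using k I by (simp add: less_divide_eq)
  then obtain c' where c': "c < c'" "c' < k / I" using dense by blast
  have kc': "c' * I < k" using c' I by (simp add: less_divide_eq)
  obtain Y where Y: "0 < Y" "\<And>x y. x \<in> X \<Longrightarrow> x0 \<le> x \<Longrightarrow> Y \<le> y \<Longrightarrow>
      measure (distr (P x) borel theta) {y<..} \<le> c' * y powr - \<alpha>"
    using cond_T_tails[OF T c c'(1)] by blast
  have "\<exists>Z>0. \<forall>z\<ge>Z. \<forall>N. prob_space N \<longrightarrow> sets N = sets borel \<longrightarrow>
    (\<forall>y\<ge>Y. measure N {y<..} \<le> c' * y powr - \<alpha>) \<longrightarrow>
    (\<integral>\<^sup>+ t. ennreal (phi (max 0 t / z)) \<partial>N) \<le> ennreal (k * z powr - \<alpha>)"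
    using \<alpha> Y(1) c c' kc' by (intro phi_expectation_upper) (auto simp: I_def)
  then obtain Z where Z: "\<And>z N. Z \<le> z \<Longrightarrow> prob_space N \<Longrightarrow> sets N = sets borel \<Longrightarrow>
    (\<forall>y\<ge>Y. measure N {y<..} \<le> c' * y powr - \<alpha>) \<Longrightarrow>
    (\<integral>\<^sup>+ t. ennreal (phi (max 0 t / z)) \<partial>N) \<le> ennreal (k * z powr - \<alpha>)"
    by blast
  obtain A1 where A1: "\<And>x. x \<in> X \<Longrightarrow> A1 \<le> x \<Longrightarrow> integrable (distr (P x) borel theta) (\<lambda>t. t)"
    using cond_T_integrable[OF T] by blast
  obtain B where B: "0 \<le> B" "\<And>x. x \<in> X \<Longrightarrow> x0 \<le> x \<Longrightarrow>
    (\<integral>\<^sup>+ t. ennreal (neg_part t powr \<beta>) \<partial>distr (P x) borel theta) \<le> ennreal B"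
    using cond_T_neg_moment[OF T] by blast
  \<comment> \<open>The expansion asks for b \<le> 2, its error term for b > \<alpha>, and moments
    are available up to \<beta>; the minimum satisfies all three since \<alpha> < 2 and \<alpha> <
    \<beta>.\<close>
  define b where "b = min \<beta> 2"
  have b: "1 < b" "b \<le> 2" "b \<le> \<beta>" "\<alpha> < b" using \<alpha> by (auto simp: b_def)
  have "((\<lambda>z. (1 + 2 / (1 + ln z)) * k + 8 * (1 + B) * (1 + ln z)\<^sup>2 * z powr - (b - \<alpha>)) \<longlongrightarrow> k) at_top"
  proof -
    define d where "d = b - \<alpha>"
    have "0 < d" using b by (simp add: d_def)
    then have "((\<lambda>z. (1 + ln z)\<^sup>2 * z powr - d) \<longlongrightarrow> 0) at_top"
      by real_asymp
    moreover have "((\<lambda>z::real. (1 + 2 / (1 + ln z))) \<longlongrightarrow> 1) at_top" by real_asymp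
    ultimately have "((\<lambda>z. (1 + 2 / (1 + ln z)) * k + 8 * (1 + B) * ((1 + ln z)\<^sup>2 * z powr - d)) \<longlongrightarrow> 1 * k + 8 * (1 + B) * 0) at_top"
      by (intro tendsto_intros)
    then show ?thesis by (simp add: d_def mult.assoc)
  qed
  then have "eventually (\<lambda>z. (1 + 2 / (1 + ln z)) * k + 8 * (1 + B) * (1 + ln z)\<^sup>2 * z powr - (b - \<alpha>) < k0) at_top"
    using k by (intro order_tendstoD) auto
  then obtain A2 where A2: "\<And>z. A2 \<le> z \<Longrightarrow> (1 + 2 / (1 + ln z)) * k + 8 * (1 + B) * (1 + ln z)\<^sup>2 * z powr - (b - \<alpha>) < k0"
    by (auto simp: eventually_at_top_linorder)
  define A where "A = Max {0, x0, A0, A1, A2, Z}"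
  have A: "0 \<le> A" "x0 \<le> A" "A0 \<le> A" "A1 \<le> A" "A2 \<le> A" "Z \<le> A" by (auto simp: A_def)
  show ?thesis
  proof (rule transient_criterion[OF N, of "\<lambda>x. ennreal (1 / (1 + ln (1 + max 0 x)))" A])
    show "antimono (\<lambda>x. ennreal (1 / (1 + ln (1 + max 0 x))))"
      by (intro antimonoI ennreal_leI divide_left_mono) (auto intro!: mult_pos_pos add_pos_nonneg)
    show "0 < ennreal (1 / (1 + ln (1 + max 0 x)))" for x
      by (auto intro!: add_pos_nonneg)
    have "((\<lambda>x::real. 1 / (1 + ln (1 + max 0 x))) \<longlongrightarrow> 0) at_top"
      by real_asymp
    then show "((\<lambda>x. ennreal (1 / (1 + ln (1 + max 0 x)))) \<longlongrightarrow> 0) at_top"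
      using tendsto_ennrealI by fastforce
    fix x assume x: "x \<in> X" "A < x"
    define z where "z = 1 + x"
    define L where "L = 1 + ln z"
    have x0: "0 < x" "1 \<le> z" "z > 0" using x A by (auto simp: z_def)
    interpret D: prob_space "distr (P x) borel theta" by (rule prob_space_increment[OF x(1)])
    have "(\<integral>\<^sup>+ y. ennreal (1 / (1 + ln (1 + max 0 y))) \<partial>K x)
      = (\<integral>\<^sup>+ t. ennreal (1 / (1 + ln (1 + max 0 (x + t)))) \<partial>distr (P x) borel theta)"
      by (rule nn_integral_increment[OF x(1)]) measurable
    also have "\<dots> = (\<integral>\<^sup>+ t. ennreal (1 / (1 + ln (z + t))) \<partial>distr (P x) borel theta)"
      by (rule nn_integral_cong_AE, rule AE_mp[OF AE_increment[OF x(1)]]) (auto simp: z_def max_def add.assoc)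
    also have "\<dots> \<le> ennreal (1 / L)"
    proof (rule inverse_ln_supermartingale_step[where J = "k * z powr - \<alpha>" and B = "1 + B" and b = b])
      show "AE t in distr (P x) borel theta. 1 \<le> z + t"
        using AE_increment[OF x(1)] by (rule AE_mp) (auto simp: z_def)
      show "integrable (distr (P x) borel theta) (\<lambda>t. t)" using A1 x A by auto
      show "(\<integral>\<^sup>+ t. ennreal (phi (max 0 t / z)) \<partial>distr (P x) borel theta) \<le> ennreal (k * z powr - \<alpha>)"
        by (rule Z) (use x A Y D.prob_space_axioms in \<open>auto simp: z_def\<close>)
      \<comment> \<open>Lowering the exponent from \<beta> to \<open>b\<close> costs an additive 1,
        hence the constant \<open>1 + B\<close>.\<close>
      have "(\<integral>\<^sup>+ t. ennreal (neg_part t powr b) \<partial>distr (P x) borel theta)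
         \<le> (\<integral>\<^sup>+ t. 1 + ennreal (neg_part t powr \<beta>) \<partial>distr (P x) borel theta)"
      proof (rule nn_integral_mono)
        fix t
        have "neg_part t powr b \<le> 1 + neg_part t powr \<beta>"
          using b by (intro le_one_plus_powr) (auto simp: neg_part_def)
        then show "ennreal (neg_part t powr b) \<le> 1 + ennreal (neg_part t powr \<beta>)"
          by (simp flip: ennreal_1 ennreal_plus add: ennreal_leI)
      qed
      also have "\<dots> = 1 + (\<integral>\<^sup>+ t. ennreal (neg_part t powr \<beta>) \<partial>distr (P x) borel theta)"
        using D.emeasure_space_1 by (subst nn_integral_add) auto
      also have "\<dots> \<le> 1 + ennreal B" using B(2)[of x] x A by (intro add_left_mono) auto
      finally show "(\<integral>\<^sup>+ t. ennreal (neg_part t powr b) \<partial>distr (P x) borel theta) \<le> ennreal (1 + B)"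
        using B(1) by simp
      have "z powr (\<alpha> - 1) * z powr - \<alpha> = 1 / z" "z powr - (b - \<alpha>) * z powr - \<alpha> = z powr - b"
        using x0 powr_add[of z "\<alpha> - 1" "- \<alpha>"] powr_add[of z "\<alpha> - b" "- \<alpha>"]
        by (simp_all add: powr_minus_divide)
      note pw = this
      \<comment> \<open>With a positive drift, replacing x by the larger z = 1 + x in the power only
        helps, so no ratio z / x has to be controlled here.\<close>
      have "0 < x powr (\<alpha> - 1) * drift P x" using A0[of x] x A k \<open>0 < c * I\<close> by simp
      then have dpos: "0 < drift P x" by (simp add: zero_less_mult_iff)
      have "((1 + 2 / L) * k + 8 * (1 + B) * L\<^sup>2 * z powr - (b - \<alpha>)) * z powr - \<alpha> \<le> k0 * z powr - \<alpha>"
        using A2[of z] x A by (intro mult_right_mono) (auto simp: L_def z_def)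
      also have "\<dots> \<le> x powr (\<alpha> - 1) * drift P x * z powr - \<alpha>"
        using A0[of x] x A by (intro mult_right_mono) auto
      also have "\<dots> \<le> z powr (\<alpha> - 1) * drift P x * z powr - \<alpha>"
        using dpos x0 \<alpha> by (intro mult_right_mono powr_mono2) (auto simp: z_def)
      also have "\<dots> = drift P x / z"
        using pw(1) by (simp add: mult.assoc mult.left_commute)
      also have "((1 + 2 / L) * k + 8 * (1 + B) * L\<^sup>2 * z powr - (b - \<alpha>)) * z powr - \<alpha>
        = (1 + 2 / L) * (k * z powr - \<alpha>) + 8 * (1 + B) * L\<^sup>2 * z powr - b"
        unfolding pw(2)[symmetric] by (simp only: distrib_right mult.assoc)
      finally show "(1 + 2 / L) * (k * z powr - \<alpha>) + 8 * (1 + B) * L\<^sup>2 * z powr - b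
          \<le> (\<integral>t. t \<partial>distr (P x) borel theta) / z"
        unfolding drift_increment[OF x(1)] .
    qed (use x0 D.prob_space_axioms b B(1) k \<open>0 < c * I\<close> in \<open>auto simp: L_def\<close>)
    also have "ennreal (1 / L) = ennreal (1 / (1 + ln (1 + max 0 x)))" using x0 by (simp add: z_def L_def)
    finally show "(\<integral>\<^sup>+ y. ennreal (1 / (1 + ln (1 + max 0 y))) \<partial>K x) \<le> ennreal (1 / (1 + ln (1 + max 0 x)))" .
  qed auto
qed

text \<open>For \<open>p\<close> above 1 + \<gamma> the linear term is at most
  \<open>p * x powr q * e\<close> with q = p - 1 - \<gamma> > 0 and e < 0, so it tends to
  -\<infinity>. For \<open>p\<close> below \<alpha> the Taylor remainder stays bounded.\<close>

lemma positive_recurrent_if_negative_drift: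
  assumes \<alpha>: "1 < \<alpha>" "\<alpha> < 2" and \<gamma>: "\<gamma> < \<alpha> - 1"
    and mom: "Limsup (at_top_in X) (\<lambda>x. \<integral>\<^sup>+ \<omega>. ennreal (\<bar>theta \<omega>\<bar> powr \<alpha>) \<partial>(P x)) < \<infinity>"
    and lim: "Limsup (at_top_in X) (\<lambda>x. ereal (x powr \<gamma> * drift P x)) < 0"
  shows "positive_recurrent X P"
proof -
  obtain b where b: "Limsup (at_top_in X) (\<lambda>x. \<integral>\<^sup>+ \<omega>. ennreal (\<bar>theta \<omega>\<bar> powr \<alpha>) \<partial>(P x)) < b" "b < \<infinity>"
    using dense[OF mom] by blast
  obtain B where B: "0 \<le> B" "b = ennreal B" using b(2) by (cases b) auto
  have "eventually (\<lambda>x. (\<integral>\<^sup>+ \<omega>. ennreal (\<bar>theta \<omega>\<bar> powr \<alpha>) \<partial>(P x)) < b) (at_top_in X)"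
    using b(1) by (rule Limsup_lessD)
  then obtain A0 where A0: "\<And>x. x \<in> X \<Longrightarrow> A0 \<le> x \<Longrightarrow> (\<integral>\<^sup>+ \<omega>. ennreal (\<bar>theta \<omega>\<bar> powr \<alpha>) \<partial>(P x)) < ennreal B"
    by (auto simp: eventually_at_top_in B)
  obtain e where e: "Limsup (at_top_in X) (\<lambda>x. ereal (x powr \<gamma> * drift P x)) < ereal e" "e < 0"
    using ereal_dense2[OF lim] by auto
  have "eventually (\<lambda>x. ereal (x powr \<gamma> * drift P x) < ereal e) (at_top_in X)"
    using e(1) by (rule Limsup_lessD)
  then obtain A1 where A1: "\<And>x. x \<in> X \<Longrightarrow> A1 \<le> x \<Longrightarrow> x powr \<gamma> * drift P x < e"
    by (auto simp: eventually_at_top_in)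
  \<comment> \<open>The maximum with 1 covers \<gamma> \<le> 0, since the Taylor bound requires p >
    1.\<close>
  have "max 1 (1 + \<gamma>) < \<alpha>" using \<alpha> \<gamma> by auto
  then obtain p where p': "max 1 (1 + \<gamma>) < p" "p < \<alpha>" using dense by blast
  then have p: "1 < p" "1 + \<gamma> < p" by auto
  define q where "q = p - 1 - \<gamma>"
  have q: "0 < q" using p by (simp add: q_def)
  have pe: "0 < p * - e" using p e by (simp add: mult_pos_neg)
  have "filterlim (\<lambda>x. (p * - e) * x powr q) at_top at_top"
    using q pe by real_asymp
  then have "eventually (\<lambda>x. 1 + p * (1 + B) \<le> (p * - e) * x powr q) at_top"
    by (simp only: filterlim_at_top)
  then obtain A2 where A2: "\<And>x. A2 \<le> x \<Longrightarrow> 1 + p * (1 + B) \<le> (p * - e) * x powr q"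
    by (auto simp: eventually_at_top_linorder)
  define A where "A = Max {0, A0, A1, A2}"
  have A: "0 \<le> A" "A0 \<le> A" "A1 \<le> A" "A2 \<le> A" by (auto simp: A_def)
  have super: "1 + (\<integral>\<^sup>+ y. ennreal (max 0 y powr p) \<partial>K x) \<le> ennreal (max 0 x powr p)"
    if x: "x \<in> X" "A < x" for x
  proof -
    have x0: "0 < x" using x A by simp
    interpret D: prob_space "distr (P x) borel theta" by (rule prob_space_increment[OF x(1)])
    have "(\<integral>\<^sup>+ y. ennreal (max 0 y powr p) \<partial>K x)
      = (\<integral>\<^sup>+ t. ennreal (max 0 (x + t) powr p) \<partial>distr (P x) borel theta)"
      by (rule nn_integral_increment[OF x(1)]) measurable
    also have "\<dots> = (\<integral>\<^sup>+ t. ennreal ((x + t) powr p) \<partial>distr (P x) borel theta)"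
      by (rule nn_integral_cong_AE, rule AE_mp[OF AE_increment[OF x(1)]]) (auto simp: max_def)
    finally have eq: "(\<integral>\<^sup>+ y. ennreal (max 0 y powr p) \<partial>K x) = (\<integral>\<^sup>+ t. ennreal ((x + t) powr p) \<partial>distr (P x) borel theta)" .
    have "1 + (\<integral>\<^sup>+ t. ennreal ((x + t) powr p) \<partial>distr (P x) borel theta) \<le> ennreal (x powr p)"
    proof (rule powr_supermartingale_step[where B = B and \<alpha> = \<alpha>])
      show "AE t in distr (P x) borel theta. 0 \<le> x + t" by (rule AE_increment[OF x(1)])
      show "(\<integral>\<^sup>+ t. ennreal (\<bar>t\<bar> powr \<alpha>) \<partial>distr (P x) borel theta) \<le> ennreal B"
        using A0[of x] x A by (subst nn_integral_distr) auto
      have "x powr (p - 1) = x powr q * x powr \<gamma>" by (simp add: powr_add[symmetric] q_def)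
      then have "p * x powr (p - 1) * drift P x = p * x powr q * (x powr \<gamma> * drift P x)" by simp
      also have "\<dots> \<le> p * x powr q * e"
        using A1[of x] x A p by (intro mult_left_mono) auto
      finally show "p * x powr (p - 1) * (\<integral>t. t \<partial>distr (P x) borel theta) + p * (1 + B) \<le> - 1"
        unfolding drift_increment[OF x(1)] using A2[of x] x A by (simp add: mult.assoc mult.left_commute mult.commute)
    qed (use x0 D.prob_space_axioms p p' \<alpha> B in auto)
    then show ?thesis using eq x0 by simp
  qed
  show ?thesis
    unfolding positive_recurrent_def
  proof (intro exI[of _ A] allI impI ballI)
    fix a x assume a: "A \<le> a" and x: "x \<in> X"
    \<comment> \<open>The Lyapunov inequality beyond \<open>A\<close> holds in particular beyond
      \<open>a\<close>, so one function serves every level.\<close>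
    have "(\<integral>\<^sup>+ \<omega>. hit_time a \<omega> \<partial>P x) \<le> ennreal (max 0 x powr p)"
      using a super x by (intro expected_hit_time_le) auto
    then show "(\<integral>\<^sup>+ \<omega>. hit_time a \<omega> \<partial>P x) < \<infinity>" by (rule le_less_trans) simp
  qed
qed

end

theorem theorem2p1:
  fixes X :: "real set" and K :: "real \<Rightarrow> real measure" and P :: "real \<Rightarrow> real stream measure"
  assumes "markov_chain X K P"
  shows "(\<forall>\<alpha> \<beta> c x0. cond_N X P \<and> cond_T X P \<alpha> \<beta> c x0 \<longrightarrow>
            (Limsup (at_top_in X) (\<lambda>x. ereal (x powr (\<alpha> - 1) * drift P x))
                < ereal (c * pi * \<bar>1 / sin (pi * \<alpha>)\<bar>) \<longrightarrow> recurrent X P) \<and>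
            (Liminf (at_top_in X) (\<lambda>x. ereal (x powr (\<alpha> - 1) * drift P x))
                > ereal (c * pi * \<bar>1 / sin (pi * \<alpha>)\<bar>) \<longrightarrow> transient X P))
       \<and> ((\<exists>\<alpha> \<gamma>. 1 < \<alpha> \<and> \<alpha> < 2 \<and> \<gamma> < \<alpha> - 1 \<and>
            Limsup (at_top_in X) (\<lambda>x. \<integral>\<^sup>+ \<omega>. ennreal (\<bar>theta \<omega>\<bar> powr \<alpha>) \<partial>(P x)) < \<infinity> \<and>
            Limsup (at_top_in X) (\<lambda>x. ereal (x powr \<gamma> * drift P x)) < 0)
          \<longrightarrow> positive_recurrent X P)"
proof -
  interpret chain X K P by standard (rule assms)
  show ?thesis
    by (intro conjI allI impI; elim exE conjE)
       (rule recurrent_if_small_drift transient_if_large_drift positive_recurrent_if_negative_drift; assumption)+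
qed

end
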